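(* Let $\Bbbk$ be a field with $\operatorname{char}\Bbbk\ne 2$, and let $\mathcal P$ be a finitely generated saturated linear operad over $\Bbbk$. Then $\mathcal P$ is (isomorphic to an operad) of the form $\mathcal{L}in_e(B)$ or $\mathcal{L}in_o(B)$, where $B$ is nilpotent.
   Context: "Operad" means a symmetric operad $\mathcal P$ in $\Bbbk$-vector spaces, given by right $\Bbbk\mathbb S_n$-modules $\mathcal P(n)$ ($n\ge 0$), an identity $1_{\mathcal P}\in\mathcal P(1)$ and partial compositions $\circ_i:\mathcal P(m)\otimes\mathcal P(n)\to\mathcal P(m+n-1)$, $1\le i\le m$, satisfying the usual unit, associativity and equivariance axioms. All operads are reduced ($\mathcal P(0)=0$) and locally finite ($\dim_\Bbbk\mathcal P(n)<\infty$). $\mathcal P$ is finitely generated if it is generated by finitely many elements as a symmetric operad. $\mathcal P$ is linear if $\dim_\Bbbk\mathcal P(n)=1$ for every $n\ge 1$. For $w\ge 2$, $\mathcal P_{\{w\}}$ is the suboperad with $\mathcal P_{\{w\}}(1)=\Bbbk 1_{\mathcal P}$, $\mathcal P_{\{w\}}(n)=0$ for $2\le n\le w-1$, $\mathcal P_{\{w\}}(n)=\mathcal P(n)$ for $n\ge w$. $\mathcal P$ is left torsionfree if the only $x\in\mathcal P$ such that, for $n\gg0$, $\mu\circ_i (x*\sigma)=0$ for all $\mu$ of arity $\ge n$, all $i$ and all permutations $\sigma$, is $x=0$. A left torsionfree operad $\mathcal P$ is saturated if for every left torsionfree operad $\mathcal Q$ and every isomorphism $\phi:\mathcal Q_{\{w\}}\to\mathcal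 P_{\{w\}}$ for some $w\ge 2$, $\phi$ extends to an injective operad homomorphism $\mathcal Q\to\mathcal P$. Algebra $B\{c\}$. Let $b\ge 0$ and let $(B,\star)$ be a unital associative $\mathbb Z/(b+1)$-graded algebra with Hilbert series $1+t+\cdots+t^b$ (each $B_i$, $0\le i\le b$, is one-dimensional). Choose a nonzero $x_i\in B_i$ for $0\le i\le b$ with $x_0=1$. $B\{c\}$ is the connected $\mathbb N$-graded algebra with $\Bbbk$-basis $\{x_ic^j: 0\le i\le b,\ j\ge 0\}$, $\deg(x_ic^j)=i+j(b+1)$, and multiplication $$x_{i_1}c^{j_1}\cdot x_{i_2}c^{j_2}=\begin{cases}(x_{i_1}\star x_{i_2})c^{j_1+j_2}, & i_1+i_2<b+1,\\ (x_{i_1}\star x_{i_2})c^{j_1+j_2+1}, & i_1+i_2\ge b+1.\end{cases}$$ $B$ is called nilpotent if $\bigoplus_{i=1}^b B_i$ is a nilpotent ideal of $B$. $\mathcal{L}in_e(B)$: here $b\ge 0$ is an integer, $B$ is commutative and nilpotent, and, with $A=B\{c\}$, $\mathcal{L}in_e(B)(n)=A_{n-1}$ for $n\ge 1$, with trivial $\mathbb S_n$-action, identity $1_A$, and $x\circ_i y=xy$ for all $i$. $\mathcal{L}in_o(B)$: here $b\ge 1$ is odd, $B$ is nilpotent and graded commutative ($xy=(-1)^{\deg x\deg y}yx$ for homogeneous $x,y$, meaningful since $b+1$ is even), and, with $A=B\{c\}$, $\mathcal{L}in_o(B)(n)=A_{n-1}$ for $n\ge 1$, with sign action $x*\sigma=\operatorname{sgn}(\sigma)x$,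 identity $1_A$, and $x\circ_i y=(-1)^{(i-1)\deg y}xy$ for homogeneous $x,y\in A$ and $1\le i\le \deg x+1$. *)

theory Defs
  imports
    "HOL-Computational_Algebra.Computational_Algebra"
    "HOL-Combinatorics.Permutations"
begin

section \<open>Symmetric operads in vector spaces\<close>

text \<open>
  All components \<open>\<P>(n)\<close> are subspaces of one ambient vector space \<open>'v\<close>; they need not be
  independent in it, since every operation carries the arities of its arguments
  (any family of vector spaces embeds in this way, for instance into its direct sum).
  \<open>act P n x \<sigma>\<close> is \<open>x * \<sigma>\<close> for \<open>x \<in> \<P>(n)\<close>, and \<open>pcomp P m n i x y\<close> is
  \<open>x \<circ>\<^sub>i y\<close> for \<open>x \<in> \<P>(m)\<close>, \<open>y \<in> \<P>(n)\<close>.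
  Values of \<open>act\<close> and \<open>pcomp\<close> outside the components are irrelevant.
\<close>

record ('k, 'v) operad_data =
  scale :: "'k \<Rightarrow> 'v \<Rightarrow> 'v"
  ops :: "nat \<Rightarrow> 'v set"
  act :: "nat \<Rightarrow> 'v \<Rightarrow> (nat \<Rightarrow> nat) \<Rightarrow> 'v"
  ident :: 'v
  pcomp :: "nat \<Rightarrow> nat \<Rightarrow> nat \<Rightarrow> 'v \<Rightarrow> 'v \<Rightarrow> 'v"

text \<open>
  The permutation \<open>\<rho>\<close> of \<open>{1..m+n-1}\<close> with
  \<open>(x * \<sigma>) \<circ>\<^sub>i (y * \<tau>) = (x \<circ>\<^bsub>\<sigma> i\<^esub> y) * \<rho>\<close>, where the action is normalised as on the
  endomorphism operad, \<open>(f * \<sigma>)(v\<^sub>1, \<dots>, v\<^sub>m) = f(v\<^bsub>\<sigma>\<^sup>-\<^sup>1(1)\<^esub>, \<dots>, v\<^bsub>\<sigma>\<^sup>-\<^sup>1(m)\<^esub>)\<close>: the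
  \<open>q\<close>-th input of the left-hand side is the \<open>\<rho>(q)\<close>-th input of \<open>x \<circ>\<^bsub>\<sigma> i\<^esub> y\<close>. The block
  \<open>{i..i+n-1}\<close> goes to the block starting at \<open>\<sigma> i\<close>, permuted internally by \<open>\<tau>\<close>.
\<close>

definition block_perm :: "nat \<Rightarrow> nat \<Rightarrow> nat \<Rightarrow> (nat \<Rightarrow> nat) \<Rightarrow> (nat \<Rightarrow> nat) \<Rightarrow> nat \<Rightarrow> nat" where
  "block_perm m n i \<sigma> \<tau> q =
    (if q < 1 \<or> m + n - 1 < q then q
     else if i \<le> q \<and> q < i + n then \<sigma> i - 1 + \<tau> (q + 1 - i)
     else let l = \<sigma> (if q < i then q else q + 1 - n)
          in if l < \<sigma> i then l else l + n - 1)"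

locale operad =
  vector_space "scale P" for P :: "('k::field, 'v::ab_group_add) operad_data" +
  assumes subspace_ops: "subspace (ops P n)"
    and ident_in: "ident P \<in> ops P 1"
    and act_in: "\<lbrakk>\<sigma> permutes {1..n}; x \<in> ops P n\<rbrakk> \<Longrightarrow> act P n x \<sigma> \<in> ops P n"
    and act_add: "\<lbrakk>\<sigma> permutes {1..n}; x \<in> ops P n; y \<in> ops P n\<rbrakk>
      \<Longrightarrow> act P n (x + y) \<sigma> = act P n x \<sigma> + act P n y \<sigma>"
    and act_scale: "\<lbrakk>\<sigma> permutes {1..n}; x \<in> ops P n\<rbrakk>
      \<Longrightarrow> act P n (scale P a x) \<sigma> = scale P a (act P n x \<sigma>)"
    and act_id: "x \<in> ops P n \<Longrightarrow> act P n x id = x"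
    and act_mult: "\<lbrakk>\<sigma> permutes {1..n}; \<tau> permutes {1..n}; x \<in> ops P n\<rbrakk>
      \<Longrightarrow> act P n x (\<sigma> \<circ> \<tau>) = act P n (act P n x \<sigma>) \<tau>"
    and pcomp_in: "\<lbrakk>x \<in> ops P m; y \<in> ops P n; 1 \<le> i; i \<le> m\<rbrakk>
      \<Longrightarrow> pcomp P m n i x y \<in> ops P (m + n - 1)"
    and pcomp_add_left: "\<lbrakk>x \<in> ops P m; x' \<in> ops P m; y \<in> ops P n; 1 \<le> i; i \<le> m\<rbrakk>
      \<Longrightarrow> pcomp P m n i (x + x') y = pcomp P m n i x y + pcomp P m n i x' y"
    and pcomp_scale_left: "\<lbrakk>x \<in> ops P m; y \<in> ops P n; 1 \<le> i; i \<le> m\<rbrakk>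
      \<Longrightarrow> pcomp P m n i (scale P a x) y = scale P a (pcomp P m n i x y)"
    and pcomp_add_right: "\<lbrakk>x \<in> ops P m; y \<in> ops P n; y' \<in> ops P n; 1 \<le> i; i \<le> m\<rbrakk>
      \<Longrightarrow> pcomp P m n i x (y + y') = pcomp P m n i x y + pcomp P m n i x y'"
    and pcomp_scale_right: "\<lbrakk>x \<in> ops P m; y \<in> ops P n; 1 \<le> i; i \<le> m\<rbrakk>
      \<Longrightarrow> pcomp P m n i x (scale P a y) = scale P a (pcomp P m n i x y)"
    and unit_left: "x \<in> ops P n \<Longrightarrow> pcomp P 1 n 1 (ident P) x = x"
    and unit_right: "\<lbrakk>x \<in> ops P n; 1 \<le> i; i \<le> n\<rbrakk> \<Longrightarrow> pcomp P n 1 i x (ident P) = x"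
    and assoc_sequential:
      "\<lbrakk>x \<in> ops P m; y \<in> ops P n; z \<in> ops P p; 1 \<le> i; i \<le> m; 1 \<le> j; j \<le> n\<rbrakk>
      \<Longrightarrow> pcomp P (m + n - 1) p (i - 1 + j) (pcomp P m n i x y) z
        = pcomp P m (n + p - 1) i x (pcomp P n p j y z)"
    and assoc_parallel:
      "\<lbrakk>x \<in> ops P m; y \<in> ops P n; z \<in> ops P p; 1 \<le> i; i < k; k \<le> m\<rbrakk>
      \<Longrightarrow> pcomp P (m + n - 1) p (k + n - 1) (pcomp P m n i x y) z
        = pcomp P (m + p - 1) n i (pcomp P m p k x z) y"
    and equivariance:
      "\<lbrakk>x \<in> ops P m; y \<in> ops P n; 1 \<le> i; i \<le> m; \<sigma> permutes {1..m}; \<tau> permutes {1..n}\<rbrakk>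
      \<Longrightarrow> pcomp P m n i (act P m x \<sigma>) (act P n y \<tau>)
        = act P (m + n - 1) (pcomp P m n (\<sigma> i) x y) (block_perm m n i \<sigma> \<tau>)"
    and reduced: "ops P 0 = {0}"
    and locally_finite: "\<exists>S. finite S \<and> ops P n = span S"

definition suboperad :: "(nat \<Rightarrow> 'v set) \<Rightarrow> ('k::field, 'v::ab_group_add) operad_data \<Rightarrow> bool" where
  "suboperad S P \<longleftrightarrow>
    (\<forall>n. S n \<subseteq> ops P n \<and> module.subspace (scale P) (S n)) \<and>
    ident P \<in> S 1 \<and>
    (\<forall>n. \<forall>x\<in>S n. \<forall>\<sigma>. \<sigma> permutes {1..n} \<longrightarrow> act P n x \<sigma> \<in> S n) \<and>
    (\<forall>m n i. \<forall>x\<in>S m. \<forall>y\<in>S n. 1 \<le> i \<and> i \<le> m \<longrightarrow> pcomp P m n i x y \<in> S (m + n - 1))"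

definition finitely_generated :: "('k::field, 'v::ab_group_add) operad_data \<Rightarrow> bool" where
  "finitely_generated P \<longleftrightarrow>
    (\<exists>G. finite G \<and> (\<forall>(n, x)\<in>G. x \<in> ops P n) \<and>
      (\<forall>S. suboperad S P \<and> (\<forall>(n, x)\<in>G. x \<in> S n) \<longrightarrow> (\<forall>n. S n = ops P n)))"

definition linear_operad :: "('k::field, 'v::ab_group_add) operad_data \<Rightarrow> bool" where
  "linear_operad P \<longleftrightarrow> (\<forall>n\<ge>1. vector_space.dim (scale P) (ops P n) = 1)"

definition operad_hom :: "(nat \<Rightarrow> 'v \<Rightarrow> 'w) \<Rightarrow> ('k::field, 'v::ab_group_add) operad_data
    \<Rightarrow> ('k, 'w::ab_group_add) operad_data \<Rightarrow> bool" where
  "operad_hom \<phi> P Q \<longleftrightarrow>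
    (\<forall>n. \<forall>x\<in>ops P n. \<phi> n x \<in> ops Q n) \<and>
    (\<forall>n. \<forall>x\<in>ops P n. \<forall>y\<in>ops P n. \<phi> n (x + y) = \<phi> n x + \<phi> n y) \<and>
    (\<forall>n a. \<forall>x\<in>ops P n. \<phi> n (scale P a x) = scale Q a (\<phi> n x)) \<and>
    (\<forall>n \<sigma>. \<forall>x\<in>ops P n. \<sigma> permutes {1..n} \<longrightarrow> \<phi> n (act P n x \<sigma>) = act Q n (\<phi> n x) \<sigma>) \<and>
    \<phi> 1 (ident P) = ident Q \<and>
    (\<forall>m n i. \<forall>x\<in>ops P m. \<forall>y\<in>ops P n. 1 \<le> i \<and> i \<le> m \<longrightarrow>
      \<phi> (m + n - 1) (pcomp P m n i x y) = pcomp Q m n i (\<phi> m x) (\<phi> n y))"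

definition operad_iso :: "(nat \<Rightarrow> 'v \<Rightarrow> 'w) \<Rightarrow> ('k::field, 'v::ab_group_add) operad_data
    \<Rightarrow> ('k, 'w::ab_group_add) operad_data \<Rightarrow> bool" where
  "operad_iso \<phi> P Q \<longleftrightarrow> operad_hom \<phi> P Q \<and> (\<forall>n. bij_betw (\<phi> n) (ops P n) (ops Q n))"

definition isomorphic_operads :: "('k::field, 'v::ab_group_add) operad_data
    \<Rightarrow> ('k, 'w::ab_group_add) operad_data \<Rightarrow> bool" where
  "isomorphic_operads P Q \<longleftrightarrow> (\<exists>\<phi>. operad_iso \<phi> P Q)"

text \<open>The suboperad \<open>\<P>\<^bsub>{w}\<^esub>\<close>, for \<open>w \<ge> 2\<close> and \<open>\<P>\<close> reduced.\<close>

definition truncation :: "nat \<Rightarrow> ('k::field, 'v::ab_group_add) operad_data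
    \<Rightarrow> ('k, 'v) operad_data" where
  "truncation w P = P\<lparr>ops := \<lambda>n. if n = 1 then range (\<lambda>a. scale P a (ident P))
                               else if n < w then {0} else ops P n\<rparr>"

definition left_torsionfree :: "('k::field, 'v::ab_group_add) operad_data \<Rightarrow> bool" where
  "left_torsionfree P \<longleftrightarrow>
    (\<forall>p. \<forall>x\<in>ops P p.
      (\<exists>N. \<forall>n\<ge>N. \<forall>\<mu>\<in>ops P n. \<forall>i\<in>{1..n}. \<forall>\<sigma>. \<sigma> permutes {1..p}
             \<longrightarrow> pcomp P n p i \<mu> (act P p x \<sigma>) = 0)
      \<longrightarrow> x = 0)"

text \<open>
  A definition cannot quantify over types, so \<open>\<Q>\<close> ranges over the operads whose components lie in
  the space \<open>'k poly\<close> of countable dimension. Since operads are locally finite, every operad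
  is isomorphic to one of these (\<open>operad_poly_model\<close> below), and the extension
  property follows for \<open>\<Q>\<close> over any type (\<open>saturated_extension\<close> below).
\<close>

definition saturated :: "('k::field, 'v::ab_group_add) operad_data \<Rightarrow> bool" where
  "saturated P \<longleftrightarrow> left_torsionfree P \<and>
    (\<forall>(Q :: ('k, 'k poly) operad_data) w \<phi>.
      operad Q \<and> left_torsionfree Q \<and> 2 \<le> w \<and> operad_iso \<phi> (truncation w Q) (truncation w P) \<longrightarrow>
      (\<exists>\<psi>. operad_hom \<psi> Q P \<and> (\<forall>n. inj_on (\<psi> n) (ops Q n)) \<and>
           (\<forall>n. \<forall>x\<in>ops (truncation w Q) n. \<psi> n x = \<phi> n x)))"


section \<open>Graded algebras and \<open>B{c}\<close>\<close>

record ('k, 'v) graded_data =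
  ascale :: "'k \<Rightarrow> 'v \<Rightarrow> 'v"
  piece :: "nat \<Rightarrow> 'v set"
  amult :: "'v \<Rightarrow> 'v \<Rightarrow> 'v"
  aone :: 'v

definition acarrier :: "nat \<Rightarrow> ('k::field, 'v::ab_group_add) graded_data \<Rightarrow> 'v set" where
  "acarrier b B = module.span (ascale B) (\<Union>i\<le>b. piece B i)"

text \<open>
  A unital associative \<open>\<int>/(b+1)\<close>-graded algebra with Hilbert series \<open>1 + t + \<dots> + t\<^sup>b\<close>; degrees
  are represented by \<open>0, \<dots>, b\<close>, and the algebra is the internal direct sum of its pieces.
\<close>

locale cyclic_graded_algebra =
  vector_space "ascale B" for b :: nat and B :: "('k::field, 'v::ab_group_add) graded_data" +
  assumes subspace_piece: "i \<le> b \<Longrightarrow> subspace (piece B i)"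
    and direct_sum: "\<lbrakk>\<And>i. i \<le> b \<Longrightarrow> v i \<in> piece B i; (\<Sum>i\<le>b. v i) = 0; j \<le> b\<rbrakk> \<Longrightarrow> v j = 0"
    and one_in: "aone B \<in> piece B 0"
    and mult_in: "\<lbrakk>i \<le> b; j \<le> b; x \<in> piece B i; y \<in> piece B j\<rbrakk>
      \<Longrightarrow> amult B x y \<in> piece B ((i + j) mod (b + 1))"
    and mult_add_left: "\<lbrakk>x \<in> acarrier b B; y \<in> acarrier b B; z \<in> acarrier b B\<rbrakk>
      \<Longrightarrow> amult B (x + y) z = amult B x z + amult B y z"
    and mult_add_right: "\<lbrakk>x \<in> acarrier b B; y \<in> acarrier b B; z \<in> acarrier b B\<rbrakk>
      \<Longrightarrow> amult B x (y + z) = amult B x y + amult B x z"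
    and mult_scale_left: "\<lbrakk>x \<in> acarrier b B; y \<in> acarrier b B\<rbrakk>
      \<Longrightarrow> amult B (ascale B a x) y = ascale B a (amult B x y)"
    and mult_scale_right: "\<lbrakk>x \<in> acarrier b B; y \<in> acarrier b B\<rbrakk>
      \<Longrightarrow> amult B x (ascale B a y) = ascale B a (amult B x y)"
    and mult_assoc: "\<lbrakk>x \<in> acarrier b B; y \<in> acarrier b B; z \<in> acarrier b B\<rbrakk>
      \<Longrightarrow> amult B (amult B x y) z = amult B x (amult B y z)"
    and one_left: "x \<in> acarrier b B \<Longrightarrow> amult B (aone B) x = x"
    and one_right: "x \<in> acarrier b B \<Longrightarrow> amult B x (aone B) = x"
    and hilbert_series: "i \<le> b \<Longrightarrow> dim (piece B i) = 1"

definition pos_part :: "nat \<Rightarrow> ('k::field, 'v::ab_group_add) graded_data \<Rightarrow> 'v set" where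
  "pos_part b B = module.span (ascale B) (\<Union>i\<in>{1..b}. piece B i)"

text \<open>\<open>I\<close> is a two-sided ideal with \<open>I\<^sup>N = 0\<close> for some \<open>N \<ge> 1\<close>, where \<open>I = B\<^sub>1 \<oplus> \<dots> \<oplus> B\<^sub>b\<close>.\<close>

definition nilpotent_algebra :: "nat \<Rightarrow> ('k::field, 'v::ab_group_add) graded_data \<Rightarrow> bool" where
  "nilpotent_algebra b B \<longleftrightarrow>
    (\<forall>a\<in>acarrier b B. \<forall>x\<in>pos_part b B.
      amult B a x \<in> pos_part b B \<and> amult B x a \<in> pos_part b B) \<and>
    (\<exists>N\<ge>1. \<forall>xs. length xs = N \<and> set xs \<subseteq> pos_part b B \<longrightarrow> foldr (amult B) xs (aone B) = 0)"

definition commutative_algebra :: "nat \<Rightarrow> ('k::field, 'v::ab_group_add) graded_data \<Rightarrow> bool" where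
  "commutative_algebra b B \<longleftrightarrow>
    (\<forall>x\<in>acarrier b B. \<forall>y\<in>acarrier b B. amult B x y = amult B y x)"

definition graded_commutative :: "nat \<Rightarrow> ('k::field, 'v::ab_group_add) graded_data \<Rightarrow> bool" where
  "graded_commutative b B \<longleftrightarrow>
    (\<forall>i\<le>b. \<forall>j\<le>b. \<forall>x\<in>piece B i. \<forall>y\<in>piece B j.
      amult B x y = ascale B ((-1) ^ (i * j)) (amult B y x))"

definition hom_part :: "nat \<Rightarrow> ('k::field, 'v::ab_group_add) graded_data \<Rightarrow> nat \<Rightarrow> 'v \<Rightarrow> 'v" where
  "hom_part b B i v = (THE u. \<exists>w. (\<forall>j\<le>b. w j \<in> piece B j) \<and> v = (\<Sum>j\<le>b. w j) \<and> u = w i)"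

text \<open>
  The algebra \<open>B{c}\<close>. Its underlying space consists of the polynomials in \<open>c\<close> with coefficients in
  \<open>B\<close>, and \<open>x c\<^sup>j\<close> is \<open>monom x j\<close>; for nonzero \<open>x\<^sub>i \<in> B\<^sub>i\<close> the elements \<open>x\<^sub>i c\<^sup>j\<close> form the
  basis of the usual description. The multiplication is the bilinear extension of
  \<open>x c\<^sup>j \<cdot> y c\<^sup>k = (x \<star> y) c\<^bsup>j+k+\<epsilon>\<^esup>\<close> for \<open>x \<in> B\<^sub>i\<close>, \<open>y \<in> B\<^sub>l\<close>, where \<open>\<epsilon> = 0\<close> if
  \<open>i + l < b + 1\<close> and \<open>\<epsilon> = 1\<close> otherwise (see \<open>adjoin_c_mult_monom\<close>); it does not depend on the
  choice of the \<open>x\<^sub>i\<close>.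
\<close>

definition adjoin_c :: "nat \<Rightarrow> ('k::field, 'v::ab_group_add) graded_data
    \<Rightarrow> ('k, 'v poly) graded_data" where
  "adjoin_c b B = \<lparr>
    ascale = (\<lambda>a. map_poly (ascale B a)),
    piece = (\<lambda>n. (\<lambda>x. monom x (n div (b + 1))) ` piece B (n mod (b + 1))),
    amult = (\<lambda>p q. \<Sum>j\<le>degree p. \<Sum>k\<le>degree q. \<Sum>i\<le>b. \<Sum>l\<le>b.
      monom (amult B (hom_part b B i (coeff p j)) (hom_part b B l (coeff q k)))
            (if i + l < b + 1 then j + k else j + k + 1)),
    aone = monom (aone B) 0\<rparr>"

definition Lin_e :: "nat \<Rightarrow> ('k::field, 'v::ab_group_add) graded_data
    \<Rightarrow> ('k, 'v poly) operad_data" where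
  "Lin_e b B = (let A = adjoin_c b B in \<lparr>
    scale = ascale A,
    ops = (\<lambda>n. if n = 0 then {0} else piece A (n - 1)),
    act = (\<lambda>n x \<sigma>. x),
    ident = aone A,
    pcomp = (\<lambda>m n i x y. amult A x y)\<rparr>)"

text \<open>An element \<open>y\<close> of arity \<open>n\<close> has degree \<open>n - 1\<close> in \<open>B{c}\<close>.\<close>

definition Lin_o :: "nat \<Rightarrow> ('k::field, 'v::ab_group_add) graded_data
    \<Rightarrow> ('k, 'v poly) operad_data" where
  "Lin_o b B = (let A = adjoin_c b B in \<lparr>
    scale = ascale A,
    ops = (\<lambda>n. if n = 0 then {0} else piece A (n - 1)),
    act = (\<lambda>n x \<sigma>. ascale A (of_int (sign \<sigma>)) x),
    ident = aone A,
    pcomp = (\<lambda>m n i x y. ascale A ((-1) ^ ((i - 1) * (n - 1))) (amult A x y))\<rparr>)"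


section \<open>Checks of the encoding\<close>

context cyclic_graded_algebra
begin

lemma piece_0: "i \<le> b \<Longrightarrow> 0 \<in> piece B i"
  using subspace_piece subspace_0 by blast

lemma hom_part_piece:
  assumes x: "x \<in> piece B i" and i: "i \<le> b" and j: "j \<le> b"
  shows "hom_part b B j x = (if j = i then x else 0)"
proof -
  define w where "w = (\<lambda>l. if l = i then x else 0)"
  have w: "\<forall>l\<le>b. w l \<in> piece B l" "x = (\<Sum>l\<le>b. w l)"
    using x i by (auto simp: w_def piece_0)
  have uniq: "w' j = w j" if w': "\<forall>l\<le>b. w' l \<in> piece B l" "x = (\<Sum>l\<le>b. w' l)" for w'
  proof -
    have "w' j - w j = 0"
    proof (rule direct_sum[where v = "\<lambda>l. w' l - w l"])
      show "w' l - w l \<in> piece B l" if "l \<le> b" for l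
        using that w w' subspace_diff[OF subspace_piece[OF that]] by blast
      show "(\<Sum>l\<le>b. w' l - w l) = 0"
        using w w' by (simp add: sum_subtractf)
    qed fact
    then show ?thesis by simp
  qed
  have "hom_part b B j x = w j"
    unfolding hom_part_def using w uniq by (intro the_equality) blast+
  then show ?thesis by (simp add: w_def)
qed

lemma piece_carrier: "i \<le> b \<Longrightarrow> x \<in> piece B i \<Longrightarrow> x \<in> acarrier b B"
  unfolding acarrier_def by (rule span_base) auto

lemma mult_zero:
  assumes "x \<in> acarrier b B"
  shows "amult B 0 x = 0" "amult B x 0 = 0"
proof -
  have 0: "0 \<in> acarrier b B"
    by (simp add: acarrier_def span_zero)
  show "amult B 0 x = 0" using mult_add_left[OF 0 0 assms] by simp
  show "amult B x 0 = 0" using mult_add_right[OF assms 0 0] by simp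
qed

lemma adjoin_c_mult_monom:
  assumes x: "x \<in> piece B i" and i: "i \<le> b" and y: "y \<in> piece B l" and l: "l \<le> b"
  shows "amult (adjoin_c b B) (monom x j) (monom y k) =
    monom (amult B x y) (if i + l < b + 1 then j + k else j + k + 1)"
proof -
  let ?e = "\<lambda>i l j k. if i + l < b + 1 then j + k else j + k + 1"
  let ?X = "\<lambda>j'. if j' = j then x else 0" and ?Y = "\<lambda>k'. if k' = k then y else 0"
  have carr: "x \<in> acarrier b B" "y \<in> acarrier b B" "0 \<in> acarrier b B"
    using piece_carrier x y i l by (auto simp: acarrier_def span_zero)
  have h: "hom_part b B i' (?X j') = (if i' = i then ?X j' else 0)"
    "hom_part b B i' (?Y j') = (if i' = l then ?Y j' else 0)" if "i' \<le> b" for i' j'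
    using that hom_part_piece[of "?X j'" i i'] hom_part_piece[of "?Y j'" l i'] x y i l piece_0
    by auto
  have eq: "monom (amult B (hom_part b B i' (coeff (monom x j) j'))
        (hom_part b B l' (coeff (monom y k) k'))) (?e i' l' j' k') =
      (if j' = j then if k' = k then if i' = i then if l' = l
        then monom (amult B x y) (?e i l j k) else 0 else 0 else 0 else 0)"
    if "i' \<le> b" "l' \<le> b" for i' l' j' k'
  proof -
    have "coeff (monom x j) j' = ?X j'" "coeff (monom y k) k' = ?Y k'" by (auto simp: coeff_monom)
    then show ?thesis
      using mult_zero carr by (simp only: h[OF that(1)] h[OF that(2)]) auto
  qed
  have "amult (adjoin_c b B) (monom x j) (monom y k) =
      (\<Sum>j'\<le>degree (monom x j). \<Sum>k'\<le>degree (monom y k). \<Sum>i'\<le>b. \<Sum>l'\<le>b.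
        if j' = j then if k' = k then if i' = i then if l' = l
        then monom (amult B x y) (?e i l j k) else 0 else 0 else 0 else 0)"
    unfolding adjoin_c_def graded_data.simps
    by (intro sum.cong refl eq) auto
  also have "\<dots> = (\<Sum>j'\<le>degree (monom x j). \<Sum>k'\<le>degree (monom y k).
        if j' = j then if k' = k then monom (amult B x y) (?e i l j k) else 0 else 0)"
  proof (intro sum.cong refl)
    fix j' k'
    show "(\<Sum>i'\<le>b. \<Sum>l'\<le>b. if j' = j then if k' = k then if i' = i then if l' = l
        then monom (amult B x y) (?e i l j k) else 0 else 0 else 0 else 0) =
      (if j' = j then if k' = k then monom (amult B x y) (?e i l j k) else 0 else 0)"
    proof (cases "j' = j \<and> k' = k")
      case True
      have "(\<Sum>l'\<le>b. if i' = i then if l' = l then z else 0 else 0) = (if i' = i then z else 0)"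
        for i' and z :: "'v poly"
        using l by simp
      then show ?thesis using True i by (simp del: add_Suc_right)
    qed auto
  qed
  also have "\<dots> = monom (amult B x y) (?e i l j k)"
  proof (cases "x = 0 \<or> y = 0")
    case True
    then have "amult B x y = 0" using mult_zero carr by auto
    then show ?thesis by (auto intro!: sum.neutral)
  next
    case False
    then have "degree (monom x j) = j" "degree (monom y k) = k" by (simp_all add: degree_monom_eq)
    moreover have "(\<Sum>k'\<le>k. if j' = j then if k' = k then z else 0 else 0) =
      (if j' = j then z else 0)" for j' and z :: "'v poly"
      by simp
    ultimately show ?thesis by (simp del: add_Suc_right)
  qed
  finally show ?thesis .
qed

end

lemma (in operad) ops_coordinates:
  "\<exists>f :: 'v \<Rightarrow> 'k poly. inj_on f (ops P n) \<and> (\<exists>S. finite S \<and> f ` ops P n = module.span smult S) \<and>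
    (\<forall>x\<in>ops P n. \<forall>y\<in>ops P n. f (x + y) = f x + f y) \<and>
    (\<forall>a. \<forall>x\<in>ops P n. f (scale P a x) = smult a (f x))"
proof -
  interpret Q: vector_space "smult :: 'k \<Rightarrow> 'k poly \<Rightarrow> 'k poly"
    by unfold_locales (simp_all add: smult_add_right smult_add_left)
  interpret L: vector_space_pair "scale P" "smult :: 'k \<Rightarrow> 'k poly \<Rightarrow> 'k poly"
    by unfold_locales
  obtain S where S: "finite S" "ops P n = span S"
    using locally_finite by blast
  obtain B where B: "B \<subseteq> S" "independent B" "S \<subseteq> span B"
    using maximal_independent_subset by blast
  have fin: "finite B" using B S finite_subset by blast
  have ops: "ops P n = span B"
    using B S span_mono[OF B(1)] span_minimal[OF B(3) subspace_span] by auto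
  obtain e :: "'v \<Rightarrow> nat" where e: "inj_on e B"
    using fin finite_imp_inj_to_nat_seg by blast
  define f where "f = L.construct B (\<lambda>v. monom 1 (e v) :: 'k poly)"
  have lin: "Vector_Spaces.linear (scale P) smult f"
    unfolding f_def by (rule L.linear_construct) fact
  interpret f: Vector_Spaces.linear "scale P" smult f by fact
  have fB: "f v = monom 1 (e v)" if "v \<in> B" for v
    unfolding f_def using L.construct_basis B(2) that by blast
  have "inj_on f (span B)"
  proof (rule inj_onI)
    fix x y assume xy: "x \<in> span B" "y \<in> span B" "f x = f y"
    define z where "z = x - y"
    have z: "z \<in> span B" "f z = 0"
      using xy span_diff by (auto simp: z_def f.diff)
    have zsum: "z = (\<Sum>v\<in>B. scale P (representation B z v) v)"
      using sum_representation_eq[OF B(2) z(1) fin] by simp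
    have "f z = (\<Sum>v\<in>B. smult (representation B z v) (f v))"
      by (subst zsum) (simp add: f.sum f.scale)
    then have sum0: "(\<Sum>v\<in>B. monom (representation B z v) (e v)) = 0"
      using z by (simp add: fB smult_monom)
    have "representation B z u = 0" if u: "u \<in> B" for u
    proof -
      have "0 = coeff (\<Sum>v\<in>B. monom (representation B z v) (e v)) (e u)"
        using sum0 by simp
      also have "\<dots> = (\<Sum>v\<in>B. if v = u then representation B z v else 0)"
        using e u by (auto simp: coeff_sum coeff_monom inj_on_eq_iff intro!: sum.cong)
      finally show ?thesis using fin u by simp
    qed
    then have "z = 0" using zsum by simp
    then show "x = y" by (simp add: z_def)
  qed
  moreover have "f ` span B = Q.span (f ` B)"
    by (simp add: f.span_image)
  ultimately show ?thesis
    using fin ops by (intro exI[of _ f]) (auto simp: f.add f.scale)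
qed

lemma operad_poly_model:
  fixes R :: "('k::field, 'w::ab_group_add) operad_data"
  assumes "operad R"
  shows "\<exists>(Q :: ('k, 'k poly) operad_data) f. operad Q \<and> operad_iso f R Q"
proof -
  interpret R: operad R by fact
  interpret V: vector_space "smult :: 'k \<Rightarrow> 'k poly \<Rightarrow> 'k poly"
    by unfold_locales (simp_all add: smult_add_right smult_add_left)
  obtain f :: "nat \<Rightarrow> 'w \<Rightarrow> 'k poly" where inj: "\<And>n. inj_on (f n) (ops R n)"
    and fin: "\<And>n. \<exists>S. finite S \<and> f n ` ops R n = V.span S"
    and add: "\<And>n x y. x \<in> ops R n \<Longrightarrow> y \<in> ops R n \<Longrightarrow> f n (x + y) = f n x + f n y"
    and scl: "\<And>n a x. x \<in> ops R n \<Longrightarrow> f n (scale R a x) = smult a (f n x)"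
    using R.ops_coordinates by metis
  define g where "g = (\<lambda>n. inv_into (ops R n) (f n))"
  have gf: "g n (f n x) = x" if "x \<in> ops R n" for n x
    using that inj by (simp add: g_def)
  have cl: "x + y \<in> ops R n" "scale R a x \<in> ops R n" if "x \<in> ops R n" "y \<in> ops R n" for n a x y
    using that R.subspace_ops R.subspace_add R.subspace_scale by blast+
  have f0: "f n 0 = 0" for n
    using add[of 0 n 0] R.subspace_0[OF R.subspace_ops, of n] by (metis add_cancel_right_right)
  have i1: "1 \<le> \<sigma> i \<and> \<sigma> i \<le> m" if "\<sigma> permutes {1..m}" "1 \<le> i" "i \<le> m" for \<sigma> and i m :: nat
    using permutes_in_image[OF that(1), of i] that by auto
  define Q :: "('k, 'k poly) operad_data" where "Q = \<lparr>scale = smult, ops = (\<lambda>n. f n ` ops R n),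
    act = (\<lambda>n y \<sigma>. f n (act R n (g n y) \<sigma>)), ident = f 1 (ident R),
    pcomp = (\<lambda>m n i x y. f (m + n - 1) (pcomp R m n i (g m x) (g n y)))\<rparr>"
  have sQ: "scale Q = smult" "\<And>n. ops Q n = f n ` ops R n"
    "\<And>n x \<sigma>. x \<in> ops R n \<Longrightarrow> act Q n (f n x) \<sigma> = f n (act R n x \<sigma>)"
    "ident Q = f 1 (ident R)"
    "\<And>m n i x y. x \<in> ops R m \<Longrightarrow> y \<in> ops R n
      \<Longrightarrow> pcomp Q m n i (f m x) (f n y) = f (m + n - 1) (pcomp R m n i x y)"
    by (simp_all add: Q_def gf)
  note scl' = scl[symmetric] and add' = add[symmetric]
  note Rin = R.act_in R.pcomp_in R.pcomp_in[simplified] R.ident_in[simplified] R.ident_in cl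
  have "operad Q"
  proof (intro operad.intro operad_axioms.intro)
    show "vector_space (scale Q)" by (simp add: sQ V.vector_space_axioms)
    show "module.subspace (scale Q) (ops Q n)" for n
      unfolding sQ using fin[of n] V.subspace_span by metis
    show "ident Q \<in> ops Q 1" using R.ident_in by (simp add: sQ)
    show "act Q n x \<sigma> \<in> ops Q n" if "\<sigma> permutes {1..n}" "x \<in> ops Q n" for \<sigma> n x
      using that by (auto simp: sQ R.act_in)
    show "act Q n (x + y) \<sigma> = act Q n x \<sigma> + act Q n y \<sigma>"
      if "\<sigma> permutes {1..n}" "x \<in> ops Q n" "y \<in> ops Q n" for \<sigma> n x y
      using that by (auto simp: sQ(2) sQ(3) add' Rin R.act_add)
    show "act Q n (scale Q a x) \<sigma> = scale Q a (act Q n x \<sigma>)"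
      if "\<sigma> permutes {1..n}" "x \<in> ops Q n" for \<sigma> n a x
      using that by (auto simp: sQ(1-3) scl' Rin R.act_scale)
    show "act Q n x id = x" if "x \<in> ops Q n" for n x
      using that by (auto simp: sQ(2,3) R.act_id)
    show "act Q n x (\<sigma> \<circ> \<tau>) = act Q n (act Q n x \<sigma>) \<tau>"
      if "\<sigma> permutes {1..n}" "\<tau> permutes {1..n}" "x \<in> ops Q n" for \<sigma> \<tau> n x
      using that by (auto simp: sQ(2,3) Rin R.act_mult simp del: comp_apply)
    show "pcomp Q m n i x y \<in> ops Q (m + n - 1)"
      if "x \<in> ops Q m" "y \<in> ops Q n" "1 \<le> i" "i \<le> m" for x y m n i
      using that by (auto simp: sQ(2,5) Rin simp del: One_nat_def)
    show "pcomp Q m n i (x + x') y = pcomp Q m n i x y + pcomp Q m n i x' y"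
      if "x \<in> ops Q m" "x' \<in> ops Q m" "y \<in> ops Q n" "1 \<le> i" "i \<le> m" for x x' y m n i
      using that by (auto simp: sQ(2,5) Rin add' R.pcomp_add_left)
    show "pcomp Q m n i (scale Q a x) y = scale Q a (pcomp Q m n i x y)"
      if "x \<in> ops Q m" "y \<in> ops Q n" "1 \<le> i" "i \<le> m" for a x y m n i
      using that by (auto simp: sQ(1,2,5) Rin scl' R.pcomp_scale_left)
    show "pcomp Q m n i x (y + y') = pcomp Q m n i x y + pcomp Q m n i x y'"
      if "x \<in> ops Q m" "y \<in> ops Q n" "y' \<in> ops Q n" "1 \<le> i" "i \<le> m" for x y y' m n i
      using that by (auto simp: sQ(2,5) Rin add' R.pcomp_add_right)
    show "pcomp Q m n i x (scale Q a y) = scale Q a (pcomp Q m n i x y)"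
      if "x \<in> ops Q m" "y \<in> ops Q n" "1 \<le> i" "i \<le> m" for a x y m n i
      using that by (auto simp: sQ(1,2,5) Rin scl' R.pcomp_scale_right)
    show "pcomp Q 1 n 1 (ident Q) x = x" if "x \<in> ops Q n" for x n
      using that sQ(5)[OF R.ident_in, of _ n 1] R.unit_left[of _ n] by (auto simp: sQ(2,4))
    show "pcomp Q n 1 i x (ident Q) = x" if "x \<in> ops Q n" "1 \<le> i" "i \<le> n" for x n i
      using that sQ(5)[OF _ R.ident_in, of _ n i] R.unit_right[of _ n i] by (auto simp: sQ(2,4))
    show "pcomp Q (m + n - 1) p (i - 1 + j) (pcomp Q m n i x y) z
        = pcomp Q m (n + p - 1) i x (pcomp Q n p j y z)"
      if pr: "x \<in> ops Q m" "y \<in> ops Q n" "z \<in> ops Q p" "1 \<le> i" "i \<le> m" "1 \<le> j" "j \<le> n"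
      for x y z m n p i j
    proof -
      obtain x' y' z' where *: "x = f m x'" "y = f n y'" "z = f p z'"
        "x' \<in> ops R m" "y' \<in> ops R n" "z' \<in> ops R p"
        using pr unfolding sQ(2) by blast
      have "m + n - 1 + p - 1 = m + (n + p - 1) - 1" using pr by simp
      then show ?thesis
        using * pr R.assoc_sequential[of x' m y' n z' p i j]
        by (simp add: sQ(5) R.pcomp_in del: One_nat_def)
    qed
    show "pcomp Q (m + n - 1) p (k + n - 1) (pcomp Q m n i x y) z
        = pcomp Q (m + p - 1) n i (pcomp Q m p k x z) y"
      if pr: "x \<in> ops Q m" "y \<in> ops Q n" "z \<in> ops Q p" "1 \<le> i" "i < k" "k \<le> m"
      for x y z m n p i k
    proof -
      obtain x' y' z' where *: "x = f m x'" "y = f n y'" "z = f p z'"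
        "x' \<in> ops R m" "y' \<in> ops R n" "z' \<in> ops R p"
        using pr unfolding sQ(2) by blast
      have "m + n - 1 + p - 1 = m + p - 1 + n - 1" using pr by simp
      then show ?thesis
        using * pr R.assoc_parallel[of x' m y' n z' p i k]
        by (simp add: sQ(5) R.pcomp_in del: One_nat_def)
    qed
    show "pcomp Q m n i (act Q m x \<sigma>) (act Q n y \<tau>)
        = act Q (m + n - 1) (pcomp Q m n (\<sigma> i) x y) (block_perm m n i \<sigma> \<tau>)"
      if pr: "x \<in> ops Q m" "y \<in> ops Q n" "1 \<le> i" "i \<le> m" "\<sigma> permutes {1..m}" "\<tau> permutes {1..n}"
      for x y m n i \<sigma> \<tau>
    proof -
      obtain x' y' where *: "x = f m x'" "y = f n y'" "x' \<in> ops R m" "y' \<in> ops R n"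
        using pr unfolding sQ(2) by blast
      show ?thesis
        using * pr R.equivariance[of x' m y' n i \<sigma> \<tau>] i1[of \<sigma> m i]
        by (simp add: sQ(3,5) R.pcomp_in R.act_in del: One_nat_def)
    qed
    show "ops Q 0 = {0}" by (simp add: sQ R.reduced f0)
    show "\<exists>S. finite S \<and> ops Q n = module.span (scale Q) S" for n
      unfolding sQ by (rule fin)
  qed
  moreover have "operad_iso f R Q"
    unfolding operad_iso_def operad_hom_def
    using inj by (auto simp: sQ add scl bij_betw_def)
  ultimately show ?thesis by blast
qed

lemma truncation_simps:
  "scale (truncation w P) = scale P" "act (truncation w P) = act P"
  "ident (truncation w P) = ident P" "pcomp (truncation w P) = pcomp P"
  by (simp_all add: truncation_def)

lemma operad_hom_truncation_ops:
  assumes "operad_hom f P Q" "operad P" "operad Q"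
  shows "x \<in> ops (truncation w P) n \<Longrightarrow> f n x \<in> ops (truncation w Q) n"
proof -
  interpret P: operad P by fact
  interpret Q: operad Q by fact
  have "f n 0 = 0"
    using assms(1) P.subspace_0[OF P.subspace_ops, of n]
    unfolding operad_hom_def by (metis add_cancel_right_right)
  moreover have "f (Suc 0) (scale P a (ident P)) = scale Q a (ident Q)" for a
    using assms(1) P.ident_in unfolding operad_hom_def by simp
  ultimately show "x \<in> ops (truncation w P) n \<Longrightarrow> f n x \<in> ops (truncation w Q) n"
    using assms(1) unfolding operad_hom_def truncation_def by (auto split: if_splits)
qed

lemma truncation_sub:
  assumes "operad P" "x \<in> ops (truncation w P) n"
  shows "x \<in> ops P n"
proof -
  interpret P: operad P by fact
  show ?thesis
    using assms(2) P.subspace_0[OF P.subspace_ops, of n] P.ident_in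
      P.subspace_scale[OF P.subspace_ops, of "ident P" 1]
    by (auto simp: truncation_def split: if_splits)
qed

lemma operad_iso_inv:
  assumes f: "operad_iso f R Q" and R: "operad R"
  shows "operad_iso (\<lambda>n. inv_into (ops R n) (f n)) Q R"
proof -
  interpret R: operad R by fact
  define g where "g = (\<lambda>n. inv_into (ops R n) (f n))"
  have bij: "bij_betw (f n) (ops R n) (ops Q n)" for n
    using f by (simp add: operad_iso_def)
  have hom: "operad_hom f R Q" using f by (simp add: operad_iso_def)
  have gf: "g n (f n x) = x" if "x \<in> ops R n" for n x
    unfolding g_def using bij_betw_inv_into_left[OF bij that] .
  have bg: "bij_betw (g n) (ops Q n) (ops R n)" for n
    unfolding g_def using bij by (rule bij_betw_inv_into)
  have ex: "\<exists>x'. x' \<in> ops R n \<and> x = f n x'" if "x \<in> ops Q n" for x n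
    using that bij[of n] by (auto simp: bij_betw_def)
  have "operad_hom g Q R"
    unfolding operad_hom_def
  proof (intro conjI allI ballI impI)
    show "g n x \<in> ops R n" if "x \<in> ops Q n" for n x
      using that bg bij_betwE by blast
    show "g n (x + y) = g n x + g n y" if xy: "x \<in> ops Q n" "y \<in> ops Q n" for n x y
    proof -
      obtain x' y' where *: "x' \<in> ops R n" "x = f n x'" "y' \<in> ops R n" "y = f n y'"
        using xy ex by meson
      have "x + y = f n (x' + y')" using * hom by (simp add: operad_hom_def)
      then show ?thesis using * gf R.subspace_add[OF R.subspace_ops] by simp
    qed
    show "g n (scale Q a x) = scale R a (g n x)" if x: "x \<in> ops Q n" for n a x
    proof -
      obtain x' where *: "x' \<in> ops R n" "x = f n x'" using x ex by meson
      have "scale Q a x = f n (scale R a x')" using * hom by (simp add: operad_hom_def)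
      then show ?thesis using * gf R.subspace_scale[OF R.subspace_ops] by simp
    qed
    show "g n (act Q n x \<sigma>) = act R n (g n x) \<sigma>"
      if x: "x \<in> ops Q n" "\<sigma> permutes {1..n}" for n \<sigma> x
    proof -
      obtain x' where *: "x' \<in> ops R n" "x = f n x'" using x ex by meson
      have "act Q n x \<sigma> = f n (act R n x' \<sigma>)" using * x hom by (simp add: operad_hom_def)
      then show ?thesis using * x gf R.act_in by simp
    qed
    show "g 1 (ident Q) = ident R"
      using hom gf[OF R.ident_in] by (simp add: operad_hom_def)
    show "g (m + n - 1) (pcomp Q m n i x y) = pcomp R m n i (g m x) (g n y)"
      if xy: "x \<in> ops Q m" "y \<in> ops Q n" "1 \<le> i \<and> i \<le> m" for m n i x y
    proof -
      obtain x' y' where *: "x' \<in> ops R m" "x = f m x'" "y' \<in> ops R n" "y = f n y'"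
        using xy ex by meson
      have "pcomp Q m n i x y = f (m + n - 1) (pcomp R m n i x' y')"
        using * xy hom by (simp add: operad_hom_def)
      then show ?thesis using * xy gf R.pcomp_in by simp
    qed
  qed
  then show ?thesis using bg by (simp add: operad_iso_def g_def)
qed

lemma operad_hom_comp:
  assumes "operad_hom f P Q" "operad_hom g Q R"
  shows "operad_hom (\<lambda>n x. g n (f n x)) P R"
  using assms unfolding operad_hom_def by simp

lemma left_torsionfree_iso:
  assumes f: "operad_iso f R Q" and R: "operad R" and tf: "left_torsionfree R"
  shows "left_torsionfree Q"
  unfolding left_torsionfree_def
proof (intro allI ballI impI)
  interpret R: operad R by fact
  have hom: "operad_hom f R Q" and bij: "\<And>n. bij_betw (f n) (ops R n) (ops Q n)"
    using f by (auto simp: operad_iso_def)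
  have f0: "f n 0 = 0" for n
    using hom R.subspace_0[OF R.subspace_ops, of n]
    unfolding operad_hom_def by (metis add_cancel_right_right)
  fix p x
  assume x: "x \<in> ops Q p" and "\<exists>N. \<forall>n\<ge>N. \<forall>\<mu>\<in>ops Q n. \<forall>i\<in>{1..n}. \<forall>\<sigma>. \<sigma> permutes {1..p} \<longrightarrow>
    pcomp Q n p i \<mu> (act Q p x \<sigma>) = 0"
  then obtain N where N: "\<And>n \<mu> i \<sigma>. \<lbrakk>N \<le> n; \<mu> \<in> ops Q n; 1 \<le> i; i \<le> n; \<sigma> permutes {1..p}\<rbrakk> \<Longrightarrow>
    pcomp Q n p i \<mu> (act Q p x \<sigma>) = 0" by (meson atLeastAtMost_iff)
  obtain x' where x': "x' \<in> ops R p" "x = f p x'"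
    using x bij[of p] by (auto simp: bij_betw_def)
  have "pcomp R n p i \<mu> (act R p x' \<sigma>) = 0"
    if "N \<le> n" "\<mu> \<in> ops R n" "1 \<le> i" "i \<le> n" "\<sigma> permutes {1..p}" for n \<mu> i \<sigma>
  proof -
    have in1: "act R p x' \<sigma> \<in> ops R p" using that x' R.act_in by blast
    have in2: "pcomp R n p i \<mu> (act R p x' \<sigma>) \<in> ops R (n + p - 1)"
      using that in1 R.pcomp_in by blast
    have "f (n + p - 1) (pcomp R n p i \<mu> (act R p x' \<sigma>))
        = pcomp Q n p i (f n \<mu>) (act Q p (f p x') \<sigma>)"
      using hom that x' in1 by (simp add: operad_hom_def)
    also have "\<dots> = 0"
      using N[of n "f n \<mu>" i \<sigma>] that x' hom by (simp add: operad_hom_def)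
    also have "\<dots> = f (n + p - 1) 0" by (simp add: f0)
    finally show ?thesis
      using bij[of "n + p - 1"] in2 R.subspace_0[OF R.subspace_ops]
      unfolding bij_betw_def inj_on_def by blast
  qed
  then have "x' = 0"
    using tf x' unfolding left_torsionfree_def by (meson atLeastAtMost_iff)
  then show "x = 0" using x' f0 by simp
qed

lemma truncation_hom:
  assumes f: "operad_hom f P Q" and P: "operad P" and Q: "operad Q"
  shows "operad_hom f (truncation w P) (truncation w Q)"
proof -
  have "\<And>n x. x \<in> ops (truncation w P) n \<Longrightarrow> x \<in> ops P n"
    by (rule truncation_sub[OF P])
  moreover have "\<And>n x. x \<in> ops (truncation w P) n \<Longrightarrow> f n x \<in> ops (truncation w Q) n"
    by (rule operad_hom_truncation_ops[OF f P Q])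
  ultimately show ?thesis
    using f unfolding operad_hom_def by (simp add: truncation_simps)
qed

lemma truncation_iso:
  assumes f: "operad_iso f P Q" and P: "operad P" and Q: "operad Q"
  shows "operad_iso f (truncation w P) (truncation w Q)"
proof -
  let ?g = "\<lambda>n. inv_into (ops P n) (f n)"
  have hf: "operad_hom f P Q" and bij: "\<And>n. bij_betw (f n) (ops P n) (ops Q n)"
    using f by (auto simp: operad_iso_def)
  have hg: "operad_hom ?g Q P"
    using operad_iso_inv[OF f P] by (simp add: operad_iso_def)
  have "bij_betw (f n) (ops (truncation w P) n) (ops (truncation w Q) n)" for n
  proof (rule bij_betw_byWitness[where f' = "?g n"])
    show "\<forall>x\<in>ops (truncation w P) n. ?g n (f n x) = x"
      using bij truncation_sub[OF P] by (meson bij_betw_inv_into_left)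
    show "\<forall>y\<in>ops (truncation w Q) n. f n (?g n y) = y"
      using bij truncation_sub[OF Q] by (meson bij_betw_inv_into_right)
    show "f n ` ops (truncation w P) n \<subseteq> ops (truncation w Q) n"
      using operad_hom_truncation_ops[OF hf P Q] by blast
    show "?g n ` ops (truncation w Q) n \<subseteq> ops (truncation w P) n"
      using operad_hom_truncation_ops[OF hg Q P] by blast
  qed
  then show ?thesis
    using truncation_hom[OF hf P Q] by (simp add: operad_iso_def)
qed

lemma saturated_extension:
  fixes P :: "('k::field, 'v::ab_group_add) operad_data"
    and R :: "('k, 'w::ab_group_add) operad_data"
  assumes sat: "saturated P" and R: "operad R" and tf: "left_torsionfree R" and w: "2 \<le> w"
    and \<phi>: "operad_iso \<phi> (truncation w R) (truncation w P)"
  shows "\<exists>\<psi>. operad_hom \<psi> R P \<and> (\<forall>n. inj_on (\<psi> n) (ops R n)) \<and>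
    (\<forall>n. \<forall>x\<in>ops (truncation w R) n. \<psi> n x = \<phi> n x)"
proof -
  obtain Q :: "('k, 'k poly) operad_data" and f where Q: "operad Q" and f: "operad_iso f R Q"
    using operad_poly_model[OF R] by blast
  let ?g = "\<lambda>n. inv_into (ops R n) (f n)"
  have g: "operad_iso ?g Q R" by (rule operad_iso_inv[OF f R])
  have gT: "operad_iso ?g (truncation w Q) (truncation w R)"
    by (rule truncation_iso[OF g Q R])
  have "operad_iso (\<lambda>n x. \<phi> n (?g n x)) (truncation w Q) (truncation w P)"
    unfolding operad_iso_def
  proof (intro conjI allI)
    show "operad_hom (\<lambda>n x. \<phi> n (?g n x)) (truncation w Q) (truncation w P)"
      using gT \<phi> operad_hom_comp[of ?g "truncation w Q" "truncation w R" \<phi> "truncation w P"]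
      by (simp add: operad_iso_def)
    show "bij_betw (\<lambda>x. \<phi> n (?g n x)) (ops (truncation w Q) n) (ops (truncation w P) n)" for n
      using gT \<phi> bij_betw_trans[of "?g n" _ _ "\<phi> n"]
      unfolding operad_iso_def comp_def by blast
  qed
  then have "\<exists>\<psi>. operad_hom \<psi> Q P \<and> (\<forall>n. inj_on (\<psi> n) (ops Q n)) \<and>
      (\<forall>n. \<forall>x\<in>ops (truncation w Q) n. \<psi> n x = \<phi> n (?g n x))"
    using sat[unfolded saturated_def, THEN conjunct2, rule_format,
        of Q w "\<lambda>n x. \<phi> n (?g n x)"] Q left_torsionfree_iso[OF f R tf] w by simp
  then obtain \<psi> where \<psi>: "operad_hom \<psi> Q P" "\<And>n. inj_on (\<psi> n) (ops Q n)"
    "\<And>n x. x \<in> ops (truncation w Q) n \<Longrightarrow> \<psi> n x = \<phi> n (?g n x)"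
    by blast
  have hf: "operad_hom f R Q" and bij: "\<And>n. bij_betw (f n) (ops R n) (ops Q n)"
    using f by (auto simp: operad_iso_def)
  show ?thesis
  proof (intro exI[of _ "\<lambda>n x. \<psi> n (f n x)"] conjI allI ballI)
    show "operad_hom (\<lambda>n x. \<psi> n (f n x)) R P"
      using operad_hom_comp[OF hf \<psi>(1)] .
    show "inj_on (\<lambda>x. \<psi> n (f n x)) (ops R n)" for n
      using comp_inj_on[of "f n" "ops R n" "\<psi> n"] bij[of n] \<psi>(2)[of n]
      by (auto simp: bij_betw_def comp_def)
    show "\<psi> n (f n x) = \<phi> n x" if "x \<in> ops (truncation w R) n" for n x
      using that \<psi>(3) operad_hom_truncation_ops[OF hf R Q] truncation_sub[OF R]
        bij_betw_inv_into_left[OF bij] by metis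
  qed
qed

end

theory Submission
  imports Defs "HOL-Library.Multiset"
begin

text \<open>
  Write \<open>e\<^sub>n\<close> for a generator of the line \<open>\<P>(n + 1)\<close>, with \<open>e\<^sub>0\<close> the identity, and call \<open>n\<close> its
  degree. A one-dimensional representation of a symmetric group is trivial or the sign, so
  \<open>\<P>\<close> is described by one sign per positive degree and by the scalars \<open>C m n i\<close> with
  \<open>e\<^sub>m \<circ>\<^sub>i e\<^sub>n = C m n i \<cdot> e\<^bsub>m+n\<^esub>\<close>. Equivariance expresses \<open>C m n (i + 1)\<close> through \<open>C m n i\<close> by a
  sign, hence everything is encoded in the graded associative product \<open>x y = x \<circ>\<^sub>1 y\<close>. Moreover a
  nonzero product has the sign of its right factor, if that has positive degree
  (\<open>sgn_at_right_factor\<close>).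

  The main point is that this product has a homogeneous regular element. The parallel axiom gives
  \<open>x y z = \<plusminus> x z y\<close> for \<open>x\<close> of positive degree, and left torsionfreeness cancels \<open>x\<close>; so whether
  \<open>y z\<close> vanishes does not depend on the order of the factors (\<open>nz_sym\<close>). The pattern of vanishing
  products is therefore a commutative monoid with zero, with one nonzero element in each degree.
  It is finitely generated, and infinite; if all generators were nilpotent it would be finite. If
  \<open>e\<^sub>d\<close> and \<open>e\<^sub>i\<close> are both non-nilpotent, then \<open>e\<^sub>i\<^sup>d\<close> and \<open>e\<^sub>d\<^sup>i\<close> are nonzero of the same degree, so they
  agree up to a scalar. Hence a non-nilpotent \<open>e\<^sub>d\<close> divides every element of large degree, and
  torsionfreeness shows that \<open>e\<^sub>d\<close> kills nothing (\<open>ex_regular_degree\<close>).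

  Take \<open>d\<close> minimal and \<open>c = e\<^sub>d\<close>. All products with \<open>c\<close> are nonzero, so all signs agree with the
  sign \<open>s\<close> in degree \<open>d\<close>, and cancelling \<open>c\<close> in the parallel axiom gives \<open>y z = s\<^bsup>|y||z|\<^esup> z y\<close>. From
  \<open>c c \<noteq> 0\<close> and \<open>2 \<noteq> 0\<close> it follows that \<open>d\<close> is even if \<open>s = -1\<close>. The basis can be
  rescaled so that \<open>c e\<^sub>n = e\<^bsub>d+n\<^esub>\<close>; the structure constants are then periodic modulo \<open>d = b + 1\<close>, which
  says precisely that the product is that of \<open>B{c}\<close>, where \<open>B\<close> has basis \<open>e\<^sub>0, \<dots>, e\<^sub>b\<close>
  (\<open>operad_iso_to_Lin\<close>). By minimality of \<open>d\<close> the elements \<open>e\<^sub>1, \<dots>, e\<^sub>b\<close> are nilpotent; so the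
  product of two of them is never a nonzero multiple of \<open>c\<close>, they span an ideal of \<open>B\<close>, and a
  long product of them contains a high power of one of them (\<open>nilpotent_algebra\<close>).
\<close>

section \<open>Commutative monoids with zero, one element in each degree\<close>

text \<open>
  \<open>nz i j\<close> means that the product of the elements of degrees \<open>i\<close> and \<open>j\<close> is nonzero; it then is,
  up to a scalar, the element of degree \<open>i + j\<close>. The assumptions are what unitality,
  commutativity and associativity up to scalars say about the vanishing of products.
\<close>

locale nonvanishing_products =
  fixes nz :: "nat \<Rightarrow> nat \<Rightarrow> bool"
  assumes nz_0: "nz 0 i"
    and nz_sym: "nz i j \<Longrightarrow> nz j i"
    and nz_assoc: "nz i j \<and> nz (i + j) k \<longleftrightarrow> nz j k \<and> nz i (j + k)"
begin

text \<open>
  The monoid itself: \<open>Some n\<close> is the element of degree \<open>n\<close>, and \<open>None\<close> is zero. Making it an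
  instance of the library's monoids provides products of multisets, independent of order and
  bracketing.
\<close>

definition mul :: "nat option \<Rightarrow> nat option \<Rightarrow> nat option" where
  "mul x y = (case (x, y) of (Some i, Some j) \<Rightarrow> if nz i j then Some (i + j) else None | _ \<Rightarrow> None)"

lemma mul_simps [simp]:
  "mul (Some i) (Some j) = (if nz i j then Some (i + j) else None)"
  "mul None y = None" "mul x None = None"
  by (simp_all add: mul_def split: option.split)

sublocale degrees: comm_monoid_mset mul "Some 0"
proof unfold_locales
  fix x y z
  show "mul (mul x y) z = mul x (mul y z)"
  proof (cases "x = None \<or> y = None \<or> z = None")
    case True
    then show ?thesis by (auto simp: mul_def split: option.splits)
  next
    case False
    then obtain i j k where "x = Some i" "y = Some j" "z = Some k" by auto
    then show ?thesis using nz_assoc[of i j k] by (auto simp: mul_def add.assoc)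
  qed
  show "mul x y = mul y x"
    using nz_sym by (auto simp: mul_def add.commute split: option.splits)
  show "mul x (Some 0) = x"
    using nz_0 nz_sym by (auto simp: mul_def split: option.splits)
qed

definition nonzero :: "nat multiset \<Rightarrow> bool" where
  "nonzero A \<longleftrightarrow> degrees.F (image_mset Some A) \<noteq> None"

lemma F_eq: "nonzero A \<Longrightarrow> degrees.F (image_mset Some A) = Some (\<Sum>\<^sub># A)"
proof (induction A)
  case (add i A)
  then show ?case
    by (cases "degrees.F (image_mset Some A)") (auto simp: nonzero_def split: if_splits)
qed simp

lemma nonzero_empty [simp]: "nonzero {#}"
  by (simp add: nonzero_def)

text \<open>
  Two nonzero products with the same total degree are the same monoid element, so either may
  replace the other inside a larger product; this lemma makes that visible, because the
  right-hand side refers to \<open>A\<close> only through its degree and its being nonzero.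
\<close>

lemma nonzero_union: "nonzero (A + B) \<longleftrightarrow> nonzero A \<and> nonzero B \<and> nz (\<Sum>\<^sub># A) (\<Sum>\<^sub># B)"
proof -
  have F: "degrees.F (image_mset Some (A + B))
      = mul (degrees.F (image_mset Some A)) (degrees.F (image_mset Some B))"
    by simp
  show ?thesis
  proof (cases "nonzero A \<and> nonzero B")
    case True
    then show ?thesis
      using F by (simp add: nonzero_def[of "A + B"] F_eq)
  next
    case False
    then show ?thesis
      using F by (auto simp: nonzero_def)
  qed
qed

lemma nonzero_add_mset: "nonzero (add_mset i A) \<longleftrightarrow> nonzero A \<and> nz i (\<Sum>\<^sub># A)"
proof -
  have "nonzero {#i#}" using nz_0 nz_sym by (simp add: nonzero_def)
  then show ?thesis using nonzero_union[of "{#i#}" A] by simp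
qed

lemma nonzero_subset: "A \<subseteq># B \<Longrightarrow> nonzero B \<Longrightarrow> nonzero A"
  using nonzero_union[of A "B - A"] by (simp add: subset_mset.add_diff_inverse)

definition nilpotent_degree :: "nat \<Rightarrow> bool" where
  "nilpotent_degree i \<longleftrightarrow> (\<exists>k. \<not> nonzero (replicate_mset k i))"

lemma pigeonhole_mset:
  fixes k :: "nat \<Rightarrow> nat"
  assumes "finite F" "set_mset A \<subseteq> F" "(\<Sum>i\<in>F. k i) < size A"
  shows "\<exists>i\<in>F. replicate_mset (k i) i \<subseteq># A"
proof (rule ccontr)
  assume "\<not> ?thesis"
  then have "count A i \<le> k i" if "i \<in> F" for i
    using that nat_le_linear[of "k i" "count A i"] by (auto simp: count_le_replicate_mset_subset_eq)
  then have "(\<Sum>i\<in>F. count A i) \<le> (\<Sum>i\<in>F. k i)" by (rule sum_mono)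
  moreover have "size A = (\<Sum>i\<in>F. count A i)"
    unfolding size_multiset_overloaded_eq
    using assms by (intro sum.mono_neutral_left) (auto simp: not_in_iff)
  ultimately show False using assms by simp
qed

lemma nilpotent_products_vanish:
  assumes "finite F" "\<And>i. i \<in> F \<Longrightarrow> nilpotent_degree i"
  shows "\<exists>K. \<forall>A. set_mset A \<subseteq> F \<longrightarrow> K < size A \<longrightarrow> \<not> nonzero A"
proof -
  obtain k where "\<not> nonzero (replicate_mset (k i) i)" if "i \<in> F" for i
    using assms(2) unfolding nilpotent_degree_def by metis
  then show ?thesis
    using pigeonhole_mset[OF assms(1)] nonzero_subset by meson
qed

end

text \<open>
  Decomposability above \<open>M\<close> expresses generation in degrees at most \<open>M\<close>.
\<close>

locale finitely_generated_products = nonvanishing_products +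
  fixes M :: nat
  assumes decomposable: "M < n \<Longrightarrow> \<exists>p\<ge>1. \<exists>q\<ge>1. p + q = n \<and> nz p q"
    and torsionfree: "\<exists>n\<ge>N. nz n i"
begin

lemma generators: "\<exists>A. set_mset A \<subseteq> {1..M} \<and> nonzero A \<and> \<Sum>\<^sub># A = n"
proof (induction n rule: less_induct)
  case (less n)
  consider "n = 0" | "1 \<le> n" "n \<le> M" | "M < n" by linarith
  then show ?case
  proof cases
    case 1
    then show ?thesis by (intro exI[of _ "{#}"]) simp
  next
    case 2
    then show ?thesis
      using nonzero_add_mset[of n "{#}"] nz_0 nz_sym by (intro exI[of _ "{#n#}"]) simp
  next
    case 3
    then obtain p q where pq: "p \<ge> 1" "q \<ge> 1" "p + q = n" "nz p q"
      using decomposable by blast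
    then obtain A B where "set_mset A \<subseteq> {1..M}" "nonzero A" "\<Sum>\<^sub># A = p"
      "set_mset B \<subseteq> {1..M}" "nonzero B" "\<Sum>\<^sub># B = q"
      using less.IH[of p] less.IH[of q] by auto
    then show ?thesis
      using pq nonzero_union[of A B] by (intro exI[of _ "A + B"]) auto
  qed
qed

lemma sum_mset_le_size: "set_mset A \<subseteq> {1..M} \<Longrightarrow> \<Sum>\<^sub># A \<le> M * size A"
  by (induction A) auto

lemma generators_of_size:
  assumes "M * K < n"
  obtains A where "set_mset A \<subseteq> {1..M}" "nonzero A" "\<Sum>\<^sub># A = n" "K < size A"
proof -
  obtain A where A: "set_mset A \<subseteq> {1..M}" "nonzero A" "\<Sum>\<^sub># A = n"
    using generators by blast
  then have "M * K < M * size A"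
    using assms sum_mset_le_size[of A] by linarith
  then have "K < size A" by (metis nat_mult_less_cancel_disj)
  then show ?thesis using A that by blast
qed

lemma ex_nonnilpotent: "\<exists>i\<ge>1. \<not> nilpotent_degree i"
proof (rule ccontr)
  assume "\<not> ?thesis"
  then obtain K where "\<And>A. set_mset A \<subseteq> {1..M} \<Longrightarrow> K < size A \<Longrightarrow> \<not> nonzero A"
    using nilpotent_products_vanish[of "{1..M}"] by auto
  moreover obtain A where "set_mset A \<subseteq> {1..M}" "nonzero A" "K < size A"
    using generators_of_size[of K "M * K + 1"] by auto
  ultimately show False by blast
qed

text \<open>
  A long nonzero product of generators contains some generator \<open>i\<close> at least \<open>d\<close> times, where \<open>i\<close>
  is not nilpotent because nilpotent generators occur with bounded multiplicity. The \<open>d\<close>-th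
  power of degree \<open>i\<close> is the \<open>i\<close>-th power of degree \<open>d\<close>, which contains \<open>d\<close>.
\<close>

lemma nonnilpotent_divides:
  assumes d: "1 \<le> d" "\<not> nilpotent_degree d"
  shows "\<exists>N. \<forall>n\<ge>N. \<exists>m. n = d + m \<and> nz d m"
proof -
  \<comment> \<open>The multiplicity that matters for the generator \<open>i\<close>: impossible if \<open>i\<close> is nilpotent, and \<open>d\<close> otherwise.\<close>
  have "\<exists>k. nilpotent_degree i \<and> \<not> nonzero (replicate_mset k i) \<or> \<not> nilpotent_degree i \<and> k = d" for i
    unfolding nilpotent_degree_def by blast
  then obtain k where k: "\<And>i. nilpotent_degree i \<and> \<not> nonzero (replicate_mset (k i) i) \<or>
      \<not> nilpotent_degree i \<and> k i = d"
    by metis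
  define K where "K = (\<Sum>i\<in>{1..M}. k i)"
  have "\<exists>m. n = d + m \<and> nz d m" if n: "M * K + 1 \<le> n" for n
  proof -
    obtain A where A: "set_mset A \<subseteq> {1..M}" "nonzero A" "\<Sum>\<^sub># A = n" "K < size A"
      using generators_of_size[of K n] n by auto
    obtain i where i: "i \<in> {1..M}" "replicate_mset (k i) i \<subseteq># A"
      using pigeonhole_mset[of "{1..M}" A k] A unfolding K_def by auto
    have ki: "k i = d"
      using k[of i] nonzero_subset[OF i(2) A(2)] by blast
    define C where "C = A - replicate_mset d i"
    have AC: "A = replicate_mset d i + C"
      using i(2) unfolding ki C_def by simp
    then have nz: "nonzero C" "nz (d * i) (\<Sum>\<^sub># C)" and n': "n = d * i + \<Sum>\<^sub># C"
      using A nonzero_union[of "replicate_mset d i" C] by (auto simp: sum_mset_replicate_mset)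
    have "nonzero (replicate_mset i d)" using d unfolding nilpotent_degree_def by blast
    then have "nonzero (replicate_mset i d + C)"
      using nz nonzero_union by (simp add: sum_mset_replicate_mset mult.commute)
    moreover obtain i' where i': "i = Suc i'" using i by (cases i) auto
    ultimately have "nz d (\<Sum>\<^sub># (replicate_mset i' d + C))"
      by (simp add: nonzero_add_mset)
    moreover have "n = d + \<Sum>\<^sub># (replicate_mset i' d + C)"
      unfolding n' i' by (simp add: sum_mset_replicate_mset)
    ultimately show ?thesis by blast
  qed
  then show ?thesis by blast
qed

text \<open>
  An element killed by \<open>d\<close> would be killed by all multiples of \<open>d\<close>, that is, in all large
  degrees, and so would be torsion.
\<close>

lemma nonnilpotent_regular:
  assumes d: "1 \<le> d" "\<not> nilpotent_degree d"
  shows "nz d i"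
proof -
  obtain N where N: "\<And>n. N \<le> n \<Longrightarrow> \<exists>m. n = d + m \<and> nz d m"
    using nonnilpotent_divides[OF d] by blast
  obtain n where n: "N \<le> n" "nz n i" using torsionfree by blast
  obtain m where m: "n = d + m" "nz d m" using N[OF n(1)] by blast
  have "nz m d \<and> nz (m + d) i" using n m nz_sym by (simp add: add.commute)
  then show ?thesis using nz_assoc by blast
qed

theorem ex_regular_degree:
  obtains d where "1 \<le> d" "\<And>i. nz d i" "\<And>i. 1 \<le> i \<Longrightarrow> i < d \<Longrightarrow> nilpotent_degree i"
proof -
  define d where "d = (LEAST i. 1 \<le> i \<and> \<not> nilpotent_degree i)"
  have d: "1 \<le> d \<and> \<not> nilpotent_degree d"
    unfolding d_def by (rule LeastI_ex) (use ex_nonnilpotent in blast)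
  show ?thesis
  proof (rule that[of d])
    show "nilpotent_degree i" if "1 \<le> i" "i < d" for i
      using that(1) not_less_Least[OF that(2)[unfolded d_def]] by blast
  qed (use d nonnilpotent_regular in auto)
qed

end

text \<open>
  If a regular element were a product with a nilpotent factor, all of its powers would contain
  powers of that factor, yet they are nonzero.
\<close>

lemma (in nonvanishing_products) nilpotent_complement:
  assumes i: "nilpotent_degree i" and reg: "\<And>m. nz (i + j) m"
  shows "\<not> nz i j"
proof
  assume "nz i j"
  then have ij: "nonzero {#i, j#}" using nz_0 nz_sym by (simp add: nonzero_add_mset)
  have "nonzero (repeat_mset k {#i, j#})" for k
  proof (induction k)
    case (Suc k)
    have "repeat_mset (Suc k) {#i, j#} = {#i, j#} + repeat_mset k {#i, j#}" by simp
    then show ?case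
      using Suc ij reg nonzero_union[of "{#i, j#}" "repeat_mset k {#i, j#}"]
      by (simp only:) simp
  qed simp
  moreover have "replicate_mset k i \<subseteq># repeat_mset k {#i, j#}" for k
    by (simp flip: count_le_replicate_mset_subset_eq)
  ultimately show False using i nonzero_subset unfolding nilpotent_degree_def by blast
qed

section \<open>Structure constants and signs of a linear operad\<close>

text \<open>
  The cyclic permutation \<open>i \<mapsto> i + 1 \<mapsto> \<dots> \<mapsto> i + n \<mapsto> i\<close>, which moves a block of \<open>n\<close> inputs past one
  input.
\<close>

definition cycle :: "nat \<Rightarrow> nat \<Rightarrow> nat \<Rightarrow> nat" where
  "cycle i n q = (if i \<le> q \<and> q < i + n then Suc q else if q = i + n then i else q)"

lemma cycle_0: "cycle i 0 = id"
  by (auto simp: cycle_def fun_eq_iff)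

lemma cycle_Suc: "cycle i (Suc n) = transpose i (Suc (i + n)) \<circ> cycle i n"
  by (auto simp: cycle_def fun_eq_iff transpose_def)

lemma cycle_permutes: "1 \<le> i \<Longrightarrow> i + n \<le> N \<Longrightarrow> cycle i n permutes {1..N}"
proof (induction n)
  case 0
  show ?case unfolding cycle_0 by (rule permutes_id)
next
  case (Suc n)
  then show ?case
    unfolding cycle_Suc by (intro permutes_compose permutes_swap_id) auto
qed

lemma block_perm_adjacent_transposition:
  assumes "1 \<le> i" "i \<le> m"
  shows "block_perm (Suc m) (Suc n) i (transpose i (Suc i)) id = cycle i (Suc n)"
proof
  fix q
  consider "q < 1" | "1 \<le> q" "q < i" | "i \<le> q" "q < i + Suc n" | "q = i + Suc n"
    | "i + Suc n < q" "q \<le> m + Suc n" | "m + Suc n < q"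
    by linarith
  then show "block_perm (Suc m) (Suc n) i (transpose i (Suc i)) id q = cycle i (Suc n) q"
    by cases (use assms in \<open>auto simp: block_perm_def cycle_def transpose_def Let_def\<close>)
qed

lemma block_perm_inner_transposition:
  "1 \<le> n \<Longrightarrow> block_perm (Suc m) (Suc n) 1 id (transpose 1 2) = transpose 1 2"
  by (auto simp: block_perm_def transpose_def Let_def fun_eq_iff)

text \<open>
  The one-dimensional character of the symmetric groups with value \<open>s\<close> on transpositions, for
  \<open>s = \<plusminus>1\<close>; it treats the trivial and the sign action uniformly.
\<close>

definition sign_twist :: "'k::field \<Rightarrow> (nat \<Rightarrow> nat) \<Rightarrow> 'k" where
  "sign_twist s \<sigma> = (if evenperm \<sigma> then 1 else s)"

lemma sign_twist_trivial: "sign_twist 1 \<sigma> = 1"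
  by (simp add: sign_twist_def)

lemma sign_twist_sign: "sign_twist (-1) \<sigma> = of_int (sign \<sigma>)"
  by (simp add: sign_twist_def sign_def)

text \<open>
  Stated without reference to a basis, so that it survives the rescaling of the basis.
\<close>

definition (in operad) nz :: "nat \<Rightarrow> nat \<Rightarrow> bool" where
  "nz i j \<longleftrightarrow> (\<exists>x\<in>ops P (Suc i). \<exists>y\<in>ops P (Suc j). pcomp P (Suc i) (Suc j) 1 x y \<noteq> 0)"

text \<open>
  A linear operad over a field of characteristic other than two with a chosen generator \<open>e n\<close> of
  each \<open>\<P>(n + 1)\<close>. Indices are degrees, which add under composition.
\<close>

locale based_linear_operad = operad P
  for P :: "('k::field, 'v::ab_group_add) operad_data" +
  fixes e :: "nat \<Rightarrow> 'v"
  assumes two_neq_0: "(2::'k) \<noteq> 0"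
    and e_neq_0: "e n \<noteq> 0"
    and ops_Suc: "ops P (Suc n) = range (\<lambda>a. scale P a (e n))"
    and e_0: "e 0 = ident P"
begin

definition coord :: "nat \<Rightarrow> 'v \<Rightarrow> 'k" where
  "coord n v = (THE a. v = scale P a (e n))"

definition C :: "nat \<Rightarrow> nat \<Rightarrow> nat \<Rightarrow> 'k" where
  "C m n i = coord (m + n) (pcomp P (Suc m) (Suc n) i (e m) (e n))"

abbreviation \<gamma> :: "nat \<Rightarrow> nat \<Rightarrow> 'k" where
  "\<gamma> m n \<equiv> C m n 1"

text \<open>
  The character through which the symmetric group acts on \<open>\<P>(n + 1)\<close>.
\<close>

definition \<chi> :: "nat \<Rightarrow> (nat \<Rightarrow> nat) \<Rightarrow> 'k" where
  "\<chi> n \<sigma> = coord n (act P (Suc n) (e n) \<sigma>)"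

text \<open>
  For \<open>n = 0\<close> the value has no meaning, as \<open>transpose 1 2\<close> does not permute \<open>{1}\<close>.
\<close>

definition sgn_at :: "nat \<Rightarrow> 'k" where
  "sgn_at n = \<chi> n (transpose 1 2)"

lemma coord_scale [simp]: "coord n (scale P a (e n)) = a"
  unfolding coord_def using e_neq_0[of n] by (intro the_equality) auto

lemma e_in: "e n \<in> ops P (Suc n)"
  unfolding ops_Suc using rangeI[of "\<lambda>a. scale P a (e n)" 1] by simp

lemma scale_coord: "v \<in> ops P (Suc n) \<Longrightarrow> scale P (coord n v) (e n) = v"
  unfolding ops_Suc by auto

lemma pcomp_e:
  assumes "1 \<le> i" "i \<le> Suc m"
  shows "pcomp P (Suc m) (Suc n) i (e m) (e n) = scale P (C m n i) (e (m + n))"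
proof -
  have "pcomp P (Suc m) (Suc n) i (e m) (e n) \<in> ops P (Suc (m + n))"
    using pcomp_in[OF e_in e_in, of i m n] assms by simp
  then show ?thesis unfolding C_def by (simp add: scale_coord)
qed

lemma pcomp_scale_e:
  assumes "1 \<le> i" "i \<le> Suc m"
  shows "pcomp P (Suc m) (Suc n) i (scale P a (e m)) (scale P b (e n))
    = scale P (a * b * C m n i) (e (m + n))"
proof -
  have "scale P b (e n) \<in> ops P (Suc n)" unfolding ops_Suc by blast
  then show ?thesis
    using assms by (simp add: pcomp_scale_left pcomp_scale_right e_in pcomp_e)
qed

lemma act_e:
  assumes "\<sigma> permutes {1..Suc n}"
  shows "act P (Suc n) (e n) \<sigma> = scale P (\<chi> n \<sigma>) (e n)"
  using act_in[OF assms e_in] unfolding \<chi>_def by (simp add: scale_coord)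

lemma act_scale_e:
  assumes "\<sigma> permutes {1..Suc n}"
  shows "act P (Suc n) (scale P a (e n)) \<sigma> = scale P (a * \<chi> n \<sigma>) (e n)"
  using assms by (simp add: act_scale e_in act_e)

lemma \<chi>_id: "\<chi> n id = 1"
  unfolding \<chi>_def using act_id[OF e_in, of n] coord_scale[of n 1] by simp

lemma \<chi>_comp:
  assumes "\<sigma> permutes {1..Suc n}" "\<tau> permutes {1..Suc n}"
  shows "\<chi> n (\<sigma> \<circ> \<tau>) = \<chi> n \<sigma> * \<chi> n \<tau>"
  unfolding \<chi>_def[of n "\<sigma> \<circ> \<tau>"] act_mult[OF assms e_in]
  using assms by (simp add: act_e act_scale_e del: comp_apply)

lemma C_assoc:
  assumes "1 \<le> i" "i \<le> Suc m" "1 \<le> j" "j \<le> Suc n"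
  shows "C m n i * C (m + n) p (i - 1 + j) = C n p j * C m (n + p) i"
proof -
  have "scale P (C m n i * C (m + n) p (i - 1 + j)) (e (m + n + p))
      = scale P (C n p j * C m (n + p) i) (e (m + n + p))"
    using assoc_sequential[OF e_in e_in e_in, of i m j n p] assms
      pcomp_scale_e[of "i - 1 + j" "m + n" p "C m n i" 1]
      pcomp_scale_e[of i m "n + p" 1 "C n p j"]
    by (simp add: pcomp_e add.assoc)
  then show ?thesis using e_neq_0 by simp
qed

lemma C_parallel:
  assumes "1 \<le> i" "i < k" "k \<le> Suc m"
  shows "C m n i * C (m + n) p (k + n) = C m p k * C (m + p) n i"
proof -
  have "scale P (C m n i * C (m + n) p (k + n)) (e (m + n + p))
      = scale P (C m p k * C (m + p) n i) (e (m + n + p))"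
    using assoc_parallel[OF e_in e_in e_in, of i k m n p] assms
      pcomp_scale_e[of "k + n" "m + n" p "C m n i" 1]
      pcomp_scale_e[of i "m + p" n "C m p k" 1]
    by (simp add: pcomp_e ac_simps)
  then show ?thesis using e_neq_0 by simp
qed

lemma C_equivariant:
  assumes "1 \<le> i" "i \<le> Suc m" "\<sigma> permutes {1..Suc m}" "\<tau> permutes {1..Suc n}"
    "block_perm (Suc m) (Suc n) i \<sigma> \<tau> permutes {1..Suc (m + n)}"
  shows "\<chi> m \<sigma> * \<chi> n \<tau> * C m n i = C m n (\<sigma> i) * \<chi> (m + n) (block_perm (Suc m) (Suc n) i \<sigma> \<tau>)"
proof -
  have "1 \<le> \<sigma> i" "\<sigma> i \<le> Suc m"
    using permutes_in_image[OF assms(3), of i] assms(1,2) by auto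
  then have "scale P (\<chi> m \<sigma> * \<chi> n \<tau> * C m n i) (e (m + n))
      = scale P (C m n (\<sigma> i) * \<chi> (m + n) (block_perm (Suc m) (Suc n) i \<sigma> \<tau>)) (e (m + n))"
    using equivariance[OF e_in e_in assms(1-4)] assms
    by (simp add: act_e pcomp_scale_e pcomp_e act_scale_e)
  then show ?thesis using e_neq_0 by simp
qed

lemma \<gamma>_0: "\<gamma> 0 n = 1"
  unfolding C_def e_0 using unit_left[OF e_in, of n] coord_scale[of n 1] by simp

lemma \<gamma>_0_right: "1 \<le> i \<Longrightarrow> i \<le> Suc m \<Longrightarrow> C m 0 i = 1"
  unfolding C_def e_0 using unit_right[OF e_in, of i m] coord_scale[of m 1] by simp

lemma nz_iff: "nz m n \<longleftrightarrow> \<gamma> m n \<noteq> 0"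
proof
  assume "nz m n"
  then obtain a b where "pcomp P (Suc m) (Suc n) 1 (scale P a (e m)) (scale P b (e n)) \<noteq> 0"
    unfolding nz_def ops_Suc by blast
  then show "\<gamma> m n \<noteq> 0" by (auto simp: pcomp_scale_e simp del: One_nat_def)
next
  assume "\<gamma> m n \<noteq> 0"
  then have "pcomp P (Suc m) (Suc n) 1 (e m) (e n) \<noteq> 0"
    using e_neq_0 by (simp add: pcomp_e del: One_nat_def)
  then show "nz m n" unfolding nz_def using e_in by blast
qed

text \<open>
  The two transpositions are conjugate under \<open>transpose b c\<close>.
\<close>

lemma \<chi>_transpose_exchange:
  assumes "{a, b, c} \<subseteq> {1..Suc n}" "distinct [a, b, c]"
  shows "\<chi> n (transpose a c) = \<chi> n (transpose a b)"
proof -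
  have p: "transpose b c permutes {1..Suc n}" "transpose a b permutes {1..Suc n}"
    using assms by (auto intro: permutes_swap_id)
  have "\<chi> n (transpose b c) * \<chi> n (transpose b c) = 1"
    using \<chi>_comp[OF p(1) p(1)] by (simp add: \<chi>_id)
  moreover have "transpose a c = transpose b c \<circ> (transpose a b \<circ> transpose b c)"
    using assms by (auto simp: fun_eq_iff transpose_def)
  moreover have "\<chi> n (transpose b c \<circ> (transpose a b \<circ> transpose b c))
      = \<chi> n (transpose b c) * (\<chi> n (transpose a b) * \<chi> n (transpose b c))"
    using p by (simp add: \<chi>_comp permutes_compose del: comp_apply)
  ultimately show ?thesis by (simp add: mult.left_commute)
qed

lemma \<chi>_transpose:
  assumes "a \<in> {1..Suc n}" "b \<in> {1..Suc n}" "a \<noteq> b"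
  shows "\<chi> n (transpose a b) = sgn_at n"
proof -
  have *: "\<chi> n (transpose 1 c) = sgn_at n" if "c \<in> {1..Suc n}" "c \<noteq> 1" for c
    using that \<chi>_transpose_exchange[of 1 2 c n] unfolding sgn_at_def by (cases "c = 2") auto
  show ?thesis
  proof (cases "a = 1 \<or> b = 1")
    case True
    then show ?thesis using *[of a] *[of b] assms by (metis transpose_commute)
  next
    case False
    then have "\<chi> n (transpose a b) = \<chi> n (transpose a 1)"
      using assms \<chi>_transpose_exchange[of a 1 b n] by auto
    then show ?thesis using *[of a] assms False by (metis transpose_commute)
  qed
qed

lemma sgn_at_cases:
  assumes "1 \<le> n"
  shows "sgn_at n = 1 \<or> sgn_at n = -1"
proof -
  have "transpose 1 2 permutes {1..Suc n}" using assms by (intro permutes_swap_id) auto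
  then have "sgn_at n * sgn_at n = 1"
    using \<chi>_comp[of "transpose 1 2" n "transpose 1 2"] by (simp add: sgn_at_def \<chi>_id)
  then show ?thesis by (simp add: square_eq_1_iff)
qed

lemma \<chi>_eq_sign_twist:
  assumes "\<sigma> permutes {1..Suc n}"
  shows "\<chi> n \<sigma> = sign_twist (sgn_at n) \<sigma>"
  using assms finite_atLeastAtMost[of 1 "Suc n"]
proof (induction rule: permutes_induct)
  case id
  then show ?case by (simp add: \<chi>_id[unfolded id_def] sign_twist_def)
next
  case (swap a b p)
  then have "1 \<le> n" by auto
  moreover have "\<chi> n (transpose a b \<circ> p) = sgn_at n * \<chi> n p"
    using swap by (simp add: \<chi>_comp permutes_swap_id \<chi>_transpose del: comp_apply)
  moreover have "permutation p" "permutation (transpose a b)"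
    using swap permutes_imp_permutation[of "{1..Suc n}" p] by (auto simp: permutation_swap_id)
  ultimately show ?case
    using swap sgn_at_cases[of n]
    by (auto simp: sign_twist_def evenperm_comp evenperm_swap simp del: comp_apply)
qed

lemma \<chi>_cycle:
  assumes "1 \<le> i" "i + k \<le> Suc n"
  shows "\<chi> n (cycle i k) = sgn_at n ^ k"
  using assms(2)
proof (induction k)
  case 0
  then show ?case unfolding cycle_0 by (simp only: \<chi>_id power_0)
next
  case (Suc k)
  have "cycle i k permutes {1..Suc n}"
    using assms Suc by (intro cycle_permutes) auto
  moreover have "transpose i (Suc (i + k)) permutes {1..Suc n}"
    using assms Suc by (intro permutes_swap_id) auto
  ultimately show ?case
    using Suc assms by (simp add: cycle_Suc \<chi>_comp \<chi>_transpose del: comp_apply)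
qed

text \<open>
  Equivariance under the transposition of the inputs \<open>i\<close> and \<open>i + 1\<close> of the left factor: on the
  composite, the block of the \<open>n + 1\<close> inputs of the right factor moves past one input.
\<close>

lemma C_next_input:
  assumes "1 \<le> i" "i \<le> m"
  shows "sgn_at m * C m n i = C m n (Suc i) * sgn_at (m + n) ^ Suc n"
proof -
  have "cycle i (Suc n) permutes {1..Suc (m + n)}"
    using assms by (intro cycle_permutes) auto
  moreover have "transpose i (Suc i) permutes {1..Suc m}"
    using assms by (intro permutes_swap_id) auto
  ultimately have "\<chi> m (transpose i (Suc i)) * \<chi> n id * C m n i
      = C m n (transpose i (Suc i) i) * \<chi> (m + n) (cycle i (Suc n))"
    using C_equivariant[of i m "transpose i (Suc i)" id n] assms
    unfolding block_perm_adjacent_transposition[OF assms] by (simp add: permutes_id)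
  then show ?thesis
    using assms \<chi>_cycle[of i "Suc n" "m + n"] by (simp add: \<chi>_id \<chi>_transpose)
qed

text \<open>
  All inputs being related by signs, the vanishing of a composition depends on the two degrees
  only.
\<close>

lemma C_neq_0_iff: "1 \<le> i \<Longrightarrow> i \<le> Suc m \<Longrightarrow> C m n i \<noteq> 0 \<longleftrightarrow> nz m n"
proof (induction i rule: nat_induct_at_least)
  case base
  then show ?case by (simp add: nz_iff)
next
  case (Suc i)
  then have "sgn_at m \<noteq> 0" "sgn_at (m + n) \<noteq> 0"
    using sgn_at_cases[of m] sgn_at_cases[of "m + n"] by auto
  then show ?case using Suc C_next_input[of i m n] by auto
qed

text \<open>
  A transposition inside the right factor is a transposition of the inputs of the composite.
\<close>

lemma sgn_at_right_factor:
  assumes "1 \<le> n" "nz m n"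
  shows "sgn_at (m + n) = sgn_at n"
proof -
  have "transpose 1 2 permutes {1..Suc n}" "transpose 1 2 permutes {1..Suc (m + n)}"
    using assms(1) by (auto intro!: permutes_swap_id)
  then have "sgn_at n * \<gamma> m n = \<gamma> m n * sgn_at (m + n)"
    using C_equivariant[of 1 m id "transpose 1 2" n] block_perm_inner_transposition[OF assms(1), of m]
    by (simp add: \<chi>_id sgn_at_def permutes_id del: One_nat_def)
  then show ?thesis using assms(2) by (simp add: nz_iff)
qed

end

section \<open>A regular element\<close>

context based_linear_operad
begin

lemma nz_assoc: "nz i j \<and> nz (i + j) k \<longleftrightarrow> nz j k \<and> nz i (j + k)"
  using C_assoc[of 1 i 1 j k] by (auto simp: nz_iff simp del: One_nat_def)

text \<open>
  The parallel axiom at the first two inputs; the left factor needs two inputs, whence \<open>1 \<le> i\<close>.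
\<close>

lemma nz_right_commute:
  assumes "1 \<le> i"
  shows "nz i j \<and> nz (i + j) k \<longleftrightarrow> nz i k \<and> nz (i + k) j"
proof -
  have "\<gamma> i j * C (i + j) k (2 + j) \<noteq> 0 \<longleftrightarrow> C i k 2 * \<gamma> (i + k) j \<noteq> 0"
    using C_parallel[of 1 2 i j k] assms by simp
  then show ?thesis
    using C_neq_0_iff[of "2 + j" "i + j" k] C_neq_0_iff[of 2 i k] assms
    by (auto simp: nz_iff simp del: One_nat_def)
qed

lemma left_torsionfree_nz:
  assumes "left_torsionfree P"
  shows "\<exists>n\<ge>N. nz n i"
proof (rule ccontr)
  assume none: "\<not> ?thesis"
  have "pcomp P n (Suc i) k \<mu> (act P (Suc i) (e i) \<sigma>) = 0"
    if n: "Suc N \<le> n" and \<mu>: "\<mu> \<in> ops P n" and k: "k \<in> {1..n}" and \<sigma>: "\<sigma> permutes {1..Suc i}"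
    for n \<mu> k \<sigma>
  proof -
    obtain m where m: "n = Suc m" "N \<le> m" using n by (cases n) auto
    obtain a where a: "\<mu> = scale P a (e m)" using \<mu> by (auto simp: m ops_Suc)
    have "C m i k = 0" using none m k C_neq_0_iff[of k m i] by auto
    then show ?thesis using k \<sigma> by (simp add: m a act_e pcomp_scale_e)
  qed
  then have "e i = 0"
    using assms e_in[of i] unfolding left_torsionfree_def by meson
  then show False using e_neq_0 by simp
qed

text \<open>
  Multiply by a high-degree \<open>e\<^sub>i\<close> on the left, where the two right factors may be exchanged.
\<close>

lemma nz_sym:
  assumes "left_torsionfree P" "nz j k"
  shows "nz k j"
proof -
  obtain i where i: "1 \<le> i" "nz i (j + k)" using left_torsionfree_nz[OF assms(1), of 1] by blast
  then have "nz i j \<and> nz (i + j) k" using assms(2) nz_assoc by blast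
  then have "nz i k \<and> nz (i + k) j" using nz_right_commute i(1) by blast
  then show ?thesis using nz_assoc by blast
qed

text \<open>
  A degree in which no product of positive degrees lands can be removed from the operad, so a
  generating set must have an element there.
\<close>

lemma suboperad_without_indecomposable:
  assumes "1 \<le> n" and indec: "\<And>p q. 1 \<le> p \<Longrightarrow> 1 \<le> q \<Longrightarrow> p + q = n \<Longrightarrow> \<not> nz p q"
  shows "suboperad (\<lambda>k. if k = Suc n then {0} else ops P k) P"
proof -
  have zero: "0 \<in> ops P k" for k using subspace_0[OF subspace_ops] .
  have act_0: "act P (Suc n) 0 \<sigma> = 0" if "\<sigma> permutes {1..Suc n}" for \<sigma>
    using act_scale[OF that zero, of 0] by simp
  have pcomp_0_left: "pcomp P k l i 0 y = 0" if "y \<in> ops P l" "1 \<le> i" "i \<le> k" for k l i y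
    using that pcomp_scale_left[OF zero, of y l i k 0] by simp
  have pcomp_0_right: "pcomp P k l i y 0 = 0" if "y \<in> ops P k" "1 \<le> i" "i \<le> k" for k l i y
    using that pcomp_scale_right[OF _ zero, of y k i l 0] by simp
  have "pcomp P k l i x y = 0"
    if kl: "k + l - 1 = Suc n" and x: "x \<in> (if k = Suc n then {0} else ops P k)"
      and y: "y \<in> (if l = Suc n then {0} else ops P l)" and i: "1 \<le> i" "i \<le> k" for k l i x y
  proof -
    consider "k = Suc n" | "l = Suc n" | "l = 0" | "2 \<le> k" "2 \<le> l"
      using kl i by linarith
    then show ?thesis
    proof cases
      case 1
      then show ?thesis using x y i pcomp_0_left zero by (auto split: if_splits)
    next
      case 2
      then show ?thesis using x y i pcomp_0_right zero by (auto split: if_splits)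
    next
      case 3
      then show ?thesis using x y i pcomp_0_right zero reduced by (auto split: if_splits)
    next
      case 4
      then obtain p q where pq: "k = Suc p" "l = Suc q" "1 \<le> p" "1 \<le> q" "p + q = n"
        using kl by (cases k; cases l) auto
      then have "C p q i = 0" using indec C_neq_0_iff[of i p q] i by auto
      moreover obtain a b where "x = scale P a (e p)" "y = scale P b (e q)"
        using x y pq by (auto simp: ops_Suc)
      ultimately show ?thesis using pq i by (simp add: pcomp_scale_e)
    qed
  qed
  then have pcomp: "pcomp P k l i x y \<in> (if k + l - 1 = Suc n then {0} else ops P (k + l - 1))"
    if "x \<in> (if k = Suc n then {0} else ops P k)" "y \<in> (if l = Suc n then {0} else ops P l)"
      "1 \<le> i" "i \<le> k" for k l i x y
    using that pcomp_in[of x k y l i] zero by (auto split: if_splits)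
  have sub: "(if k = Suc n then {0} else ops P k) \<subseteq> ops P k \<and>
      subspace (if k = Suc n then {0} else ops P k)" for k
    using zero subspace_ops by simp
  have "act P k x \<sigma> \<in> (if k = Suc n then {0} else ops P k)"
    if "x \<in> (if k = Suc n then {0} else ops P k)" "\<sigma> permutes {1..k}" for k x \<sigma>
    using that act_0 act_in by (cases "k = Suc n") auto
  then show ?thesis
    unfolding suboperad_def using pcomp sub ident_in \<open>1 \<le> n\<close> by simp
qed

lemma eventually_decomposable:
  assumes "finitely_generated P"
  shows "\<exists>M. \<forall>n>M. \<exists>p\<ge>1. \<exists>q\<ge>1. p + q = n \<and> nz p q"
proof -
  obtain G where G: "finite G" "\<forall>(n, x)\<in>G. x \<in> ops P n"
    and gen: "\<And>S. suboperad S P \<Longrightarrow> (\<forall>(n, x)\<in>G. x \<in> S n) \<Longrightarrow> (\<forall>n. S n = ops P n)"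
    using assms unfolding finitely_generated_def by (elim exE conjE) (rule that, auto)
  obtain M where M: "\<And>n. n \<in> fst ` G \<Longrightarrow> n \<le> M"
    using finite_nat_set_iff_bounded_le[of "fst ` G"] G(1) by auto
  have "\<exists>p\<ge>1. \<exists>q\<ge>1. p + q = n \<and> nz p q" if n: "M < n" for n
  proof (rule ccontr)
    assume "\<not> ?thesis"
    then have sub: "suboperad (\<lambda>k. if k = Suc n then {0} else ops P k) P"
      using n by (intro suboperad_without_indecomposable) auto
    have "x \<in> (if k = Suc n then {0} else ops P k)" if "(k, x) \<in> G" for k x
    proof -
      have "k \<le> M" using M[of k] image_eqI[of k fst "(k, x)" G] that by simp
      moreover have "x \<in> ops P k" using G(2) that by auto
      ultimately show ?thesis using n by simp
    qed
    then have "\<forall>(k, x)\<in>G. x \<in> (if k = Suc n then {0} else ops P k)" by blast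
    from gen[OF sub this] have "ops P (Suc n) = {0}" by (elim allE[of _ "Suc n"]) simp
    then show False using e_in[of n] e_neq_0 by auto
  qed
  then show ?thesis by blast
qed

lemma finitely_generated_products:
  assumes "left_torsionfree P" "finitely_generated P"
  obtains M where "finitely_generated_products nz M"
proof -
  obtain M where M: "\<forall>n>M. \<exists>p\<ge>1. \<exists>q\<ge>1. p + q = n \<and> nz p q"
    using eventually_decomposable[OF assms(2)] by blast
  have "finitely_generated_products nz M"
  proof unfold_locales
    show "nz 0 i" for i by (simp add: nz_iff \<gamma>_0 del: One_nat_def)
    show "nz i j \<Longrightarrow> nz j i" for i j by (rule nz_sym[OF assms(1)])
    show "nz i j \<and> nz (i + j) k \<longleftrightarrow> nz j k \<and> nz i (j + k)" for i j k by (rule nz_assoc)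
    show "\<exists>p\<ge>1. \<exists>q\<ge>1. p + q = n \<and> nz p q" if "M < n" for n using M that by blast
    show "\<exists>n\<ge>N. nz n i" for N i by (rule left_torsionfree_nz[OF assms(1)])
  qed
  then show ?thesis by (rule that)
qed

text \<open>
  Keep \<open>e\<^sub>0, \<dots>, e\<^bsub>d-1\<^esub>\<close> and replace \<open>e\<^bsub>qd+r\<^esub>\<close> by the \<open>q\<close>-fold left multiple of \<open>e\<^sub>r\<close> by \<open>e\<^sub>d\<close>;
  \<open>a n\<close> is the factor by which it differs from \<open>e n\<close>.
\<close>

lemma rescaled_basis:
  assumes "1 \<le> d" "\<And>n. nz d n"
  obtains f where "based_linear_operad P f" "\<And>n. based_linear_operad.C P f d n 1 = 1"
proof -
  define a where "a n = (\<Prod>q<n div d. \<gamma> d (n mod d + q * d))" for n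
  define f where "f n = scale P (a n) (e n)" for n
  have a_neq_0: "a n \<noteq> 0" for n using assms(2) by (simp add: a_def nz_iff del: One_nat_def)
  have a_small: "a 0 = 1" "a d = 1"
    using assms(1) \<gamma>_0_right[of 1 d] by (simp_all add: a_def)
  have a_step: "a (d + n) = a n * \<gamma> d n" for n
    using assms(1) by (simp add: a_def)
  have "range (\<lambda>b. scale P b (f n)) = range (\<lambda>b. scale P b (e n))" for n
  proof (intro equalityI subsetI)
    fix v assume "v \<in> range (\<lambda>b. scale P b (e n))"
    then obtain b where "v = scale P b (e n)" by blast
    then have "v = scale P (b / a n) (f n)" using a_neq_0 by (simp add: f_def)
    then show "v \<in> range (\<lambda>b. scale P b (f n))" by blast
  qed (auto simp: f_def)
  then have f: "based_linear_operad P f"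
    using two_neq_0 e_neq_0 a_neq_0 ops_Suc e_0 a_small
    by unfold_locales (simp_all add: f_def)
  interpret f: based_linear_operad P f by (rule f)
  have "pcomp P (Suc d) (Suc n) 1 (f d) (f n) = f (d + n)" for n
    unfolding f_def by (subst pcomp_scale_e) (simp_all add: a_small a_step mult.commute)
  then have "f.C d n 1 = 1" for n
    unfolding f.C_def using f.coord_scale[of "d + n" 1] by simp
  then show ?thesis using that f by blast
qed

end

lemma ex_based_linear_operad:
  fixes P :: "('k::field, 'v::ab_group_add) operad_data"
  assumes "CHAR('k) \<noteq> 2" "operad P" "linear_operad P"
  obtains e where "based_linear_operad P e"
proof -
  interpret operad P by fact
  have "\<exists>v. v \<noteq> 0 \<and> ops P (Suc n) = range (\<lambda>a. scale P a v)" for n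
  proof -
    obtain B where B: "B \<subseteq> ops P (Suc n)" "independent B" "ops P (Suc n) \<subseteq> span B"
      "card B = dim (ops P (Suc n))"
      by (rule basis_exists)
    then obtain v where v: "B = {v}"
      using assms(3) unfolding linear_operad_def by (auto simp: card_1_singleton_iff)
    have "span B = ops P (Suc n)"
      using B span_minimal[OF B(1) subspace_ops] by blast
    then show ?thesis using v B(2) by (auto simp: span_singleton)
  qed
  then obtain v where v: "\<And>n. v n \<noteq> 0" "\<And>n. ops P (Suc n) = range (\<lambda>a. scale P a (v n))"
    by metis
  obtain c where c: "ident P = scale P c (v 0)" using ident_in v(2)[of 0] by auto
  have v0: "v 0 \<in> ops P 1" using v(2)[of 0] rangeI[of "\<lambda>a. scale P a (v 0)" 1] by simp
  have c0: "c \<noteq> 0"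
  proof
    assume "c = 0"
    then have "ident P = scale P 0 (ident P)" using c by simp
    then have "pcomp P 1 1 1 (ident P) (v 0) = 0"
      using pcomp_scale_left[OF ident_in v0, of 1 0] by simp
    then show False using unit_left[OF v0] v(1) by simp
  qed
  \<comment> \<open>A generator of \<open>\<P>(1)\<close> need not be the identity, but the identity is a generator.\<close>
  define e where "e n = (if n = 0 then ident P else v n)" for n
  have "range (\<lambda>a. scale P a (v 0)) = range (\<lambda>a. scale P a (ident P))"
  proof (intro equalityI subsetI)
    fix x assume "x \<in> range (\<lambda>a. scale P a (v 0))"
    then obtain a where "x = scale P a (v 0)" by blast
    then have "x = scale P (a / c) (ident P)" using c c0 by simp
    then show "x \<in> range (\<lambda>a. scale P a (ident P))" by blast
  qed (auto simp: c)
  then have "ops P (Suc n) = range (\<lambda>a. scale P a (e n))" for n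
    unfolding e_def v(2) by simp
  moreover have "e n \<noteq> 0" for n using v(1) c c0 by (simp add: e_def)
  moreover have "(2::'k) \<noteq> 0"
  proof
    assume "(2::'k) = 0"
    then have "CHAR('k) dvd 2" using of_nat_eq_0_iff_char_dvd[of 2, where 'a = 'k] by simp
    then show False
      using assms(1) CHAR_not_1[where 'a = 'k] two_is_prime_nat unfolding prime_nat_iff by auto
  qed
  ultimately have "based_linear_operad P e" by unfold_locales (auto simp: e_def)
  then show ?thesis by (rule that)
qed

text \<open>
  Here \<open>e d\<close> is the element \<open>c\<close> of \<open>B{c}\<close>: left multiplication by it maps each \<open>e n\<close> to
  \<open>e (d + n)\<close>.
\<close>

locale regular_linear_operad =
  based_linear_operad P e + nonvanishing_products "operad.nz P"
  for P :: "('k::field, 'v::ab_group_add) operad_data" and e :: "nat \<Rightarrow> 'v" +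
  fixes d :: nat
  assumes d_pos: "1 \<le> d"
    and \<gamma>_d: "\<gamma> d n = 1"
    and nilpotent_below_d: "1 \<le> i \<Longrightarrow> i < d \<Longrightarrow> nilpotent_degree i"
begin

abbreviation s :: 'k where
  "s \<equiv> sgn_at d"

lemma nz_d: "nz d i"
  by (simp add: nz_iff \<gamma>_d del: One_nat_def)

text \<open>
  The product of \<open>e d\<close> and \<open>e i\<close> is nonzero in both orders, so its sign is that of either
  factor.
\<close>

lemma sgn_at_const: "1 \<le> i \<Longrightarrow> sgn_at i = s"
  using sgn_at_right_factor[of i d] sgn_at_right_factor[of d i] nz_d[of i] d_pos
    nonvanishing_products_axioms nonvanishing_products.nz_sym[of nz d i]
  by (simp add: add.commute)

lemma s_cases: "s = 1 \<or> s = -1"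
  using sgn_at_cases d_pos by blast

lemma s_power_square: "s ^ n * s ^ n = 1"
  using s_cases by (auto simp flip: power_mult_distrib)

lemma C_eq:
  assumes "1 \<le> i" "i \<le> Suc m"
  shows "C m n i = s ^ ((i - 1) * n) * \<gamma> m n"
  using assms
proof (induction i rule: nat_induct_at_least)
  case base
  then show ?case by simp
next
  case (Suc i)
  have "s * C m n i = C m n (Suc i) * s ^ Suc n"
    using C_next_input[of i m n] sgn_at_const[of m] sgn_at_const[of "m + n"] Suc by simp
  then have "C m n i = C m n (Suc i) * s ^ n" using s_cases by auto
  then have "C m n (Suc i) = s ^ n * C m n i"
    using s_power_square[of n] by (simp add: mult.left_commute)
  moreover have "(Suc i - 1) * n = n + (i - 1) * n" using Suc by (cases i) auto
  ultimately show ?case using Suc by (simp add: power_add mult.assoc)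
qed

lemma \<gamma>_add_d_left: "\<gamma> (d + i) j = \<gamma> i j"
  using C_assoc[of 1 d 1 i j] by (simp add: \<gamma>_d del: One_nat_def)

text \<open>
  The parallel axiom with left factor \<open>e d\<close>, which cancels; \<open>C_eq\<close> turns the two compositions at
  other inputs into products, and the signs combine to \<open>s\<^bsup>ij\<^esup>\<close>.
\<close>

lemma \<gamma>_commute: "\<gamma> j i = s ^ (i * j) * \<gamma> i j"
proof -
  \<comment> \<open>The second input of \<open>e d\<close> is input number \<open>2 + i\<close> once the \<open>i + 1\<close> inputs of \<open>e i\<close> replace the first one.\<close>
  have "\<gamma> d i * C (d + i) j (2 + i) = C d j 2 * \<gamma> (d + j) i"
    using C_parallel[of 1 2 d i j] d_pos by simp
  then have "s ^ (Suc i * j) * \<gamma> i j = s ^ j * \<gamma> j i"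
    using C_eq[of "2 + i" "d + i" j] C_eq[of 2 d j] d_pos
    by (simp add: \<gamma>_d \<gamma>_add_d_left del: One_nat_def)
  then have "s ^ j * (s ^ (i * j) * \<gamma> i j) = s ^ j * \<gamma> j i"
    by (simp add: power_add mult.assoc)
  moreover have "s ^ j \<noteq> 0" using s_cases by auto
  ultimately show ?thesis by (metis mult_left_cancel)
qed

text \<open>
  Commuting \<open>e d\<close> with itself gives \<open>s ^ (d * d) = 1\<close>, and \<open>-1 \<noteq> 1\<close>.
\<close>

lemma s_odd_case: "s = 1 \<or> s = -1 \<and> even d"
proof -
  have "s ^ (d * d) = 1" using \<gamma>_commute[of d d] by (simp add: \<gamma>_d del: One_nat_def)
  moreover have "(-1::'k) \<noteq> 1"
    using two_neq_0 by (metis add.right_inverse one_add_one)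
  ultimately show ?thesis using s_cases by (cases "even d") auto
qed

lemma s_power_d: "s ^ (d * i) = 1"
  using s_odd_case by auto

lemma \<gamma>_add_d_right: "\<gamma> i (d + j) = \<gamma> i j"
  using \<gamma>_commute[of i "d + j"] \<gamma>_commute[of i j] s_power_d[of i]
  by (simp add: \<gamma>_add_d_left add_mult_distrib power_add del: One_nat_def)

lemma \<gamma>_mod_left: "\<gamma> (i mod d) j = \<gamma> i j"
proof -
  have "\<gamma> (q * d + r) j = \<gamma> r j" for q r
    by (induction q) (simp_all add: \<gamma>_add_d_left add.assoc del: One_nat_def)
  from this[of "i div d" "i mod d"] show ?thesis by simp
qed

lemma \<gamma>_mod_right: "\<gamma> i (j mod d) = \<gamma> i j"
proof -
  have "\<gamma> i (q * d + r) = \<gamma> i r" for q r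
    by (induction q) (simp_all add: \<gamma>_add_d_right add.assoc del: One_nat_def)
  from this[of "j div d" "j mod d"] show ?thesis by simp
qed

text \<open>
  A nonzero value would exhibit \<open>e d\<close> as a product with the nilpotent factor \<open>e i\<close>.
\<close>

lemma \<gamma>_complement: "1 \<le> i \<Longrightarrow> 1 \<le> j \<Longrightarrow> i + j = d \<Longrightarrow> \<gamma> i j = 0"
  using nilpotent_complement[of i j] nilpotent_below_d[of i] nz_d by (auto simp: nz_iff)

end

theorem ex_regular_linear_operad:
  fixes P :: "('k::field, 'v::ab_group_add) operad_data"
  assumes "CHAR('k) \<noteq> 2" "operad P" "linear_operad P" "left_torsionfree P" "finitely_generated P"
  obtains e d where "regular_linear_operad P e d"
proof -
  obtain e where "based_linear_operad P e"
    using ex_based_linear_operad assms by blast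
  then interpret e: based_linear_operad P e .
  obtain M where "finitely_generated_products e.nz M"
    using e.finitely_generated_products assms by blast
  then interpret finitely_generated_products e.nz M .
  obtain d where d: "1 \<le> d" "\<And>i. e.nz d i" "\<And>i. 1 \<le> i \<Longrightarrow> i < d \<Longrightarrow> nilpotent_degree i"
    using ex_regular_degree by blast
  obtain f where f: "based_linear_operad P f" "\<And>n. based_linear_operad.C P f d n 1 = 1"
    using e.rescaled_basis d by blast
  have "regular_linear_operad P f d"
    using f d nonvanishing_products_axioms
    by (intro regular_linear_operad.intro regular_linear_operad_axioms.intro)
  then show ?thesis by (rule that)
qed

section \<open>The algebra \<open>B\<close> and the isomorphism\<close>

interpretation poly_space: vector_space "smult :: 'k::field \<Rightarrow> 'k poly \<Rightarrow> 'k poly"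
  by unfold_locales (simp_all add: smult_add_right smult_add_left)

lemma poly_monom_induct:
  fixes p :: "'a::comm_monoid_add poly"
  assumes "\<And>a i. Q (monom a i)" "\<And>p q. Q p \<Longrightarrow> Q q \<Longrightarrow> Q (p + q)"
  shows "Q p"
proof -
  have "Q (\<Sum>i\<in>I. monom (coeff p i) i)" if "finite I" for I
    using that assms(1)[of 0 0] by (induction I) (auto intro: assms)
  then show ?thesis using poly_as_sum_of_monoms[of p] by (metis finite_atMost)
qed

text \<open>
  The algebra with basis \<open>x\<^sub>0, \<dots>, x\<^sub>b\<close> and \<open>x\<^sub>i x\<^sub>j = g i j \<cdot> x\<^bsub>(i + j) mod (b + 1)\<^esub>\<close>, realised
  with \<open>x\<^sub>i = monom 1 i\<close>. The product is defined on all polynomials, ignoring the monomials of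
  degree above \<open>b\<close>, so that it is bilinear and associative without restriction.
\<close>

definition structure_algebra :: "nat \<Rightarrow> (nat \<Rightarrow> nat \<Rightarrow> 'k) \<Rightarrow> ('k::field, 'k poly) graded_data" where
  "structure_algebra b g = \<lparr>
    ascale = smult,
    piece = (\<lambda>i. range (\<lambda>a. monom a i)),
    amult = (\<lambda>p q. \<Sum>i\<le>b. \<Sum>j\<le>b. monom (coeff p i * coeff q j * g i j) ((i + j) mod (b + 1))),
    aone = monom 1 0\<rparr>"

lemma structure_algebra_simps [simp]:
  "ascale (structure_algebra b g) = smult"
  "piece (structure_algebra b g) = (\<lambda>i. range (\<lambda>a. monom a i))"
  "aone (structure_algebra b g) = monom 1 0"
  by (simp_all add: structure_algebra_def)

lemma amult_structure_algebra:
  "amult (structure_algebra b g) p q =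
    (\<Sum>i\<le>b. \<Sum>j\<le>b. monom (coeff p i * coeff q j * g i j) ((i + j) mod (b + 1)))"
  by (simp add: structure_algebra_def)

lemma amult_structure_algebra_monom:
  "amult (structure_algebra b g) (monom x i) (monom y j) =
    (if i \<le> b \<and> j \<le> b then monom (x * y * g i j) ((i + j) mod (b + 1)) else 0)"
proof -
  have "monom (coeff (monom x i) k * coeff (monom y j) l * g k l) ((k + l) mod (b + 1)) =
      (if l = j then if k = i then monom (x * y * g i j) ((i + j) mod (b + 1)) else 0 else 0)" for k l
    by (auto simp: coeff_monom)
  then show ?thesis
    unfolding amult_structure_algebra
    by (simp only: sum.delta finite_atMost) (cases "j \<le> b"; simp)
qed

lemma amult_structure_algebra_linear:
  "amult (structure_algebra b g) (p + p') q =
    amult (structure_algebra b g) p q + amult (structure_algebra b g) p' q"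
  "amult (structure_algebra b g) p (q + q') =
    amult (structure_algebra b g) p q + amult (structure_algebra b g) p q'"
  "amult (structure_algebra b g) (smult c p) q = smult c (amult (structure_algebra b g) p q)"
  "amult (structure_algebra b g) p (smult c q) = smult c (amult (structure_algebra b g) p q)"
  unfolding amult_structure_algebra
  by (simp_all add: algebra_simps add_monom[symmetric] sum.distrib smult_monom
      poly_space.scale_sum_right)

text \<open>
  The periodicity of \<open>g\<close> allows associativity to be stated for degrees in the natural numbers
  rather than modulo \<open>b + 1\<close>.
\<close>

locale structure_constants =
  fixes b :: nat and g :: "nat \<Rightarrow> nat \<Rightarrow> 'k::field"
  assumes g_0_left: "g 0 j = 1"
    and g_0_right: "g i 0 = 1"
    and g_assoc: "g i j * g (i + j) k = g j k * g i (j + k)"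
    and g_mod_left: "g (i mod (b + 1)) j = g i j"
    and g_mod_right: "g i (j mod (b + 1)) = g i j"
begin

abbreviation B :: "('k, 'k poly) graded_data" where
  "B \<equiv> structure_algebra b g"

lemma amult_assoc: "amult B (amult B p q) r = amult B p (amult B q r)"
proof (induction p rule: poly_monom_induct)
  case (1 x i)
  show ?case
  proof (induction q rule: poly_monom_induct)
    case (1 y j)
    show ?case
    proof (induction r rule: poly_monom_induct)
      case (1 z k)
      have "g i j * g ((i + j) mod (b + 1)) k = g j k * g i ((j + k) mod (b + 1))"
        unfolding g_mod_left g_mod_right by (rule g_assoc)
      then have "x * y * g i j * z * g ((i + j) mod (b + 1)) k
          = x * (y * z * g j k) * g i ((j + k) mod (b + 1))"
        by (simp add: mult.assoc mult.left_commute)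
      moreover have "((i + j) mod (b + 1) + k) mod (b + 1) = (i + (j + k) mod (b + 1)) mod (b + 1)"
        by (simp add: mod_add_left_eq mod_add_right_eq add.assoc del: add_Suc_right Suc_eq_plus1)
      moreover have "m mod (b + 1) \<le> b" for m
        using mod_less_divisor[of "b + 1" m] by linarith
      moreover have "amult B 0 p = 0" "amult B p 0 = 0" for p
        by (simp_all add: amult_structure_algebra)
      ultimately show ?case
        by (auto simp: amult_structure_algebra_monom simp del: Suc_eq_plus1)
    qed (simp add: amult_structure_algebra_linear)
  qed (simp add: amult_structure_algebra_linear)
qed (simp add: amult_structure_algebra_linear)

lemma acarrier_induct:
  assumes "p \<in> acarrier b B" "poly_space.subspace {p. Q p}" "\<And>a i. i \<le> b \<Longrightarrow> Q (monom a i)"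
  shows "Q p"
proof -
  have "poly_space.span (\<Union>i\<le>b. piece B i) \<subseteq> {p. Q p}"
    using assms(2,3) by (intro poly_space.span_minimal) auto
  then show ?thesis using assms(1) by (auto simp: acarrier_def)
qed

lemma cyclic_graded_algebra: "cyclic_graded_algebra b B"
proof (intro cyclic_graded_algebra.intro cyclic_graded_algebra_axioms.intro)
  show "vector_space (ascale B)"
    by (simp add: poly_space.vector_space_axioms)
  have sub: "piece B i = poly_space.span {monom 1 i}" for i
    by (simp add: poly_space.span_singleton smult_monom)
  then show "module.subspace (ascale B) (piece B i)" for i
    using poly_space.subspace_span by (simp del: structure_algebra_simps(2))
  have "poly_space.dim (piece B i) = 1" for i
    unfolding sub by (rule poly_space.dim_unique[of "{monom 1 i}"]) (auto intro: poly_space.span_base)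
  then show "vector_space.dim (ascale B) (piece B i) = 1" for i
    by (simp del: structure_algebra_simps(2))
  show "aone B \<in> piece B 0"
    using rangeI[of "\<lambda>a. monom a 0" "1::'k"] by simp
  show "v j = 0" if v: "\<And>i. i \<le> b \<Longrightarrow> v i \<in> piece B i" "(\<Sum>i\<le>b. v i) = 0" "j \<le> b" for v j
  proof -
    obtain a where a: "\<And>i. i \<le> b \<Longrightarrow> v i = monom (a i) i"
      using v(1) by (simp add: image_iff) metis
    have "0 = coeff (\<Sum>i\<le>b. v i) j" using v(2) by simp
    also have "\<dots> = (\<Sum>i\<le>b. if i = j then a i else 0)"
      unfolding coeff_sum using a by (intro sum.cong) (auto simp: coeff_monom)
    finally show ?thesis using a v(3) by simp
  qed
  show "amult B x y \<in> piece B ((i + j) mod (b + 1))"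
    if "i \<le> b" "j \<le> b" "x \<in> piece B i" "y \<in> piece B j" for x y i j
    using that by (auto simp: amult_structure_algebra_monom simp del: Suc_eq_plus1)
  have fixed: "poly_space.subspace {p. amult B (monom 1 0) p = p}"
    "poly_space.subspace {p. amult B p (monom 1 0) = p}"
    unfolding poly_space.subspace_def
    by (simp_all add: amult_structure_algebra_linear) (simp_all add: amult_structure_algebra)
  show "amult B (aone B) x = x" if "x \<in> acarrier b B" for x
    unfolding structure_algebra_simps using that fixed(1)
    by (rule acarrier_induct) (subst amult_structure_algebra_monom, simp add: g_0_left)
  show "amult B x (aone B) = x" if "x \<in> acarrier b B" for x
    unfolding structure_algebra_simps using that fixed(2)
    by (rule acarrier_induct) (subst amult_structure_algebra_monom, simp add: g_0_right)
qed (auto simp: amult_structure_algebra_linear amult_assoc)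

lemma commutative_algebra: "(\<And>i j. g i j = g j i) \<Longrightarrow> commutative_algebra b B"
  unfolding commutative_algebra_def amult_structure_algebra
  by (intro ballI, subst sum.swap) (simp add: ac_simps)

lemma graded_commutative:
  assumes "\<And>i j. g i j = (-1) ^ (i * j) * g j i"
  shows "graded_commutative b B"
  unfolding graded_commutative_def
proof (intro allI impI ballI)
  fix i j x y assume ij: "i \<le> b" "j \<le> b" and "x \<in> piece B i" "y \<in> piece B j"
  then obtain u v where xy: "x = monom u i" "y = monom v j" by auto
  show "amult B x y = ascale B ((-1) ^ (i * j)) (amult B y x)"
    unfolding xy using ij assms[of i j]
    by (simp add: amult_structure_algebra_monom smult_monom add.commute[of i] mult.left_commute
        mult.commute[of u] mult.assoc)
qed

end

text \<open>
  The common form of \<open>Lin_e\<close> (for \<open>s = 1\<close>) and \<open>Lin_o\<close> (for \<open>s = -1\<close>).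
\<close>

definition Lin :: "'k \<Rightarrow> nat \<Rightarrow> ('k::field, 'v::ab_group_add) graded_data
    \<Rightarrow> ('k, 'v poly) operad_data" where
  "Lin s b B = (let A = adjoin_c b B in \<lparr>
    scale = ascale A,
    ops = (\<lambda>n. if n = 0 then {0} else piece A (n - 1)),
    act = (\<lambda>n x \<sigma>. ascale A (sign_twist s \<sigma>) x),
    ident = aone A,
    pcomp = (\<lambda>m n i x y. ascale A (s ^ ((i - 1) * (n - 1))) (amult A x y))\<rparr>)"

lemma Lin_1: "ascale B 1 = (\<lambda>x. x) \<Longrightarrow> Lin 1 b B = Lin_e b B"
  by (simp add: Lin_def Lin_e_def adjoin_c_def sign_twist_trivial)

lemma Lin_minus_1: "Lin (-1) b B = Lin_o b B"
  by (simp add: Lin_def Lin_o_def sign_twist_sign)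

context regular_linear_operad
begin

declare One_nat_def [simp del]

definition b :: nat where
  "b = d - 1"

lemma b_plus_1 [simp]: "b + 1 = d" "Suc b = d"
  using d_pos by (simp_all add: b_def One_nat_def)

sublocale structure_constants b \<gamma>
proof unfold_locales
  show "\<gamma> 0 j = 1" for j by (rule \<gamma>_0)
  show "\<gamma> i 0 = 1" for i by (rule \<gamma>_0_right) simp_all
  show "\<gamma> i j * \<gamma> (i + j) k = \<gamma> j k * \<gamma> i (j + k)" for i j k
    using C_assoc[of 1 i 1 j k] by simp
  show "\<gamma> (i mod (b + 1)) j = \<gamma> i j" "\<gamma> i (j mod (b + 1)) = \<gamma> i j" for i j
    using \<gamma>_mod_left \<gamma>_mod_right unfolding b_plus_1 by simp_all
qed

lemma pos_part_coeff_0: "x \<in> pos_part b B \<Longrightarrow> coeff x 0 = 0"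
proof -
  have "poly_space.span (\<Union>i\<in>{1..b}. piece B i) \<subseteq> {x. coeff x 0 = 0}"
    by (rule poly_space.span_minimal) (auto simp: poly_space.subspace_def)
  then show "x \<in> pos_part b B \<Longrightarrow> coeff x 0 = 0" by (auto simp: pos_part_def)
qed

text \<open>
  A product of basis elements of degrees \<open>i, j \<le> b\<close>, not both zero, returns to degree 0 only if
  \<open>i + j = d\<close>, and then it vanishes by \<open>\<gamma>_complement\<close>.
\<close>

lemma amult_in_pos_part:
  assumes "coeff x 0 = 0 \<or> coeff y 0 = 0"
  shows "amult B x y \<in> pos_part b B"
proof -
  have "monom (coeff x i * coeff y j * \<gamma> i j) ((i + j) mod (b + 1)) \<in> pos_part b B"
    if ij: "i \<le> b" "j \<le> b" for i j
  proof (cases "coeff x i * coeff y j * \<gamma> i j = 0")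
    case True
    show ?thesis unfolding True by (simp add: pos_part_def poly_space.span_zero)
  next
    case False
    have "(i + j) mod (b + 1) \<noteq> 0"
    proof
      assume "(i + j) mod (b + 1) = 0"
      then have "d dvd i + j" unfolding b_plus_1 by (simp add: dvd_eq_mod_eq_0)
      then obtain k where k: "i + j = d * k" ..
      have "i + j < d * 2" using ij b_plus_1 by linarith
      then have "k < 2" using k by simp
      then consider "i = 0" "j = 0" | "i + j = d" using k by (cases k) auto
      then show False
      proof cases
        case 1
        then show False using False assms by auto
      next
        case 2
        then have "1 \<le> i" "1 \<le> j" using ij b_plus_1(2) by linarith+
        then show False using \<gamma>_complement 2 False by simp
      qed
    qed
    moreover have "(i + j) mod (b + 1) \<le> b"
      using mod_less_divisor[of "b + 1" "i + j"] by linarith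
    ultimately have "(i + j) mod (b + 1) \<in> {1..b}"
      unfolding atLeastAtMost_iff by linarith
    then show ?thesis
      unfolding pos_part_def structure_algebra_simps by (intro poly_space.span_base UN_I) auto
  qed
  then show ?thesis
    unfolding amult_structure_algebra pos_part_def structure_algebra_simps
    by (intro poly_space.span_sum) auto
qed

text \<open>
  A monomial of degree \<open>r\<close> in a product of \<open>N\<close> elements of positive degree arises from a nonzero
  product of \<open>N\<close> basis elements. The latter is formed in \<open>\<P>\<close>, where it has degree \<open>\<Sum>\<^sub># A\<close>
  instead of \<open>r\<close>; periodicity of \<open>\<gamma>\<close> makes the two agree.
\<close>

lemma foldr_amult_support:
  assumes "set xs \<subseteq> pos_part b B" "coeff (foldr (amult B) xs (aone B)) r \<noteq> 0"
  shows "\<exists>A. size A = length xs \<and> set_mset A \<subseteq> {1..b} \<and> nonzero A \<and> \<Sum>\<^sub># A mod d = r"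
  using assms
proof (induction xs arbitrary: r)
  case Nil
  then show ?case by (auto simp: coeff_monom split: if_splits)
next
  case (Cons x xs)
  define v where "v = foldr (amult B) xs (aone B)"
  have "coeff (amult B x v) r \<noteq> 0" using Cons.prems(2) by (simp add: v_def)
  then have "(\<Sum>i\<le>b. \<Sum>j\<le>b. coeff (monom (coeff x i * coeff v j * \<gamma> i j) ((i + j) mod d)) r) \<noteq> 0"
    unfolding amult_structure_algebra coeff_sum b_plus_1 .
  then obtain i where i: "i \<le> b"
    "(\<Sum>j\<le>b. coeff (monom (coeff x i * coeff v j * \<gamma> i j) ((i + j) mod d)) r) \<noteq> 0"
    by (meson sum.not_neutral_contains_not_neutral atMost_iff)
  then obtain j where j: "coeff (monom (coeff x i * coeff v j * \<gamma> i j) ((i + j) mod d)) r \<noteq> 0"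
    by (meson sum.not_neutral_contains_not_neutral)
  then have ij: "coeff x i \<noteq> 0" "coeff v j \<noteq> 0" "\<gamma> i j \<noteq> 0" "(i + j) mod d = r"
    by (auto simp: coeff_monom split: if_splits)
  have "1 \<le> i" using ij(1) pos_part_coeff_0[of x] Cons.prems(1) by (cases i) auto
  obtain A where A: "size A = length xs" "set_mset A \<subseteq> {1..b}" "nonzero A" "\<Sum>\<^sub># A mod d = j"
    using Cons.IH[of j] Cons.prems(1) ij(2) unfolding v_def by auto
  have "nz i (\<Sum>\<^sub># A)" using ij(3) \<gamma>_mod_right[of i "\<Sum>\<^sub># A"] unfolding A(4) nz_iff by simp
  then have "nonzero (add_mset i A)" using A by (simp add: nonzero_add_mset)
  moreover have "\<Sum>\<^sub># (add_mset i A) mod d = r"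
    using A(4) ij(4) by (simp add: mod_add_right_eq flip: A(4))
  ultimately show ?case
    using A \<open>1 \<le> i\<close> i(1) by (intro exI[of _ "add_mset i A"]) auto
qed

lemma nilpotent_algebra: "nilpotent_algebra b B"
proof -
  have "i < d" if "i \<in> {1..b}" for i
  proof -
    have "i \<le> b" using that by simp
    then show ?thesis using b_plus_1(2) by linarith
  qed
  then have "\<exists>K. \<forall>A. set_mset A \<subseteq> {1..b} \<longrightarrow> K < size A \<longrightarrow> \<not> nonzero A"
    by (intro nilpotent_products_vanish) (auto intro: nilpotent_below_d)
  then obtain K where K: "\<And>A. set_mset A \<subseteq> {1..b} \<Longrightarrow> K < size A \<Longrightarrow> \<not> nonzero A"
    by blast
  have "foldr (amult B) xs (aone B) = 0" if "length xs = Suc K" "set xs \<subseteq> pos_part b B" for xs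
  proof (rule poly_eqI)
    fix r
    show "coeff (foldr (amult B) xs (aone B)) r = coeff 0 r"
      using foldr_amult_support[OF that(2), of r] K that(1) by (metis coeff_0 lessI)
  qed
  then show ?thesis
    unfolding nilpotent_algebra_def using amult_in_pos_part pos_part_coeff_0
    by (intro conjI ballI exI[of _ "Suc K"]) auto
qed

text \<open>
  The element \<open>a x\<^sub>r c\<^sup>q\<close> of \<open>B{c}\<close> of degree \<open>k = q d + r\<close>.
\<close>

definition line :: "nat \<Rightarrow> 'k \<Rightarrow> 'k poly poly" where
  "line k a = monom (monom a (k mod d)) (k div d)"

definition to_Lin :: "nat \<Rightarrow> 'v \<Rightarrow> 'k poly poly" where
  "to_Lin n v = (if n = 0 then 0 else line (n - 1) (coord (n - 1) v))"

lemma to_Lin_Suc: "to_Lin (Suc k) (scale P a (e k)) = line k a"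
  by (simp add: to_Lin_def)

lemma line_0 [simp]: "line k 0 = 0"
  by (simp add: line_def)

lemma line_inject [simp]: "line k a = line k a' \<longleftrightarrow> a = a'"
  by (simp add: line_def)

lemma line_add: "line k (a + a') = line k a + line k a'"
  by (simp add: line_def add_monom)

lemma scale_line: "ascale (adjoin_c b B) c (line k a) = line k (c * a)"
  by (simp add: adjoin_c_def line_def map_poly_monom smult_monom)

text \<open>
  The carry in the multiplication of \<open>B{c}\<close> is the carry in the division of \<open>i + j\<close> by \<open>d\<close>, and
  periodicity replaces the residues by \<open>i\<close> and \<open>j\<close>.
\<close>

lemma amult_line:
  "amult (adjoin_c b B) (line i x) (line j y) = line (i + j) (x * y * \<gamma> i j)"
proof -
  interpret A: cyclic_graded_algebra b B by (rule cyclic_graded_algebra)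
  have le: "k mod d \<le> b" for k using mod_less_divisor[of d k] d_pos b_plus_1 by linarith
  have "amult B (monom x (i mod d)) (monom y (j mod d))
      = monom (x * y * \<gamma> i j) ((i + j) mod d)"
    using le d_pos by (simp add: amult_structure_algebra_monom \<gamma>_mod_left \<gamma>_mod_right mod_add_eq)
  moreover have "(if i mod d + j mod d < b + 1 then i div d + j div d else i div d + j div d + 1)
      = (i + j) div d"
  proof -
    have "(i mod d + j mod d) div d = (if i mod d + j mod d < d then 0 else 1)"
    proof -
      have "i mod d < d" "j mod d < d" using d_pos by auto
      then have "i mod d + j mod d - d < d" by linarith
      then show ?thesis by (simp add: le_div_geq One_nat_def)
    qed
    then show ?thesis using div_add1_eq[of i j d] d_pos by simp
  qed
  ultimately show ?thesis
    using A.adjoin_c_mult_monom[of "monom x (i mod d)" "i mod d" "monom y (j mod d)" "j mod d"] le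
    by (simp add: line_def)
qed

lemma operad_hom_to_Lin: "operad_hom to_Lin P (Lin s b B)"
proof -
  have zero: "0 \<in> ops P n" for n using subspace_0[OF subspace_ops] .
  have L0: "to_Lin n 0 = 0" for n
    using coord_scale[of "n - 1" 0] by (simp add: to_Lin_def)
  have Lscale: "scale (Lin s b B) = ascale (adjoin_c b B)" by (simp add: Lin_def Let_def)
  have cases: "n = 0 \<and> x = 0 \<or> (\<exists>k a. n = Suc k \<and> x = scale P a (e k))" if "x \<in> ops P n" for n x
    using that reduced by (cases n) (auto simp: ops_Suc)
  have scale0: "ascale (adjoin_c b B) c 0 = 0" for c by (simp add: adjoin_c_def)
  have piece_line: "line k a \<in> piece (adjoin_c b B) k" for k a
    using d_pos by (simp add: adjoin_c_def line_def)
  show ?thesis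
    unfolding operad_hom_def
  proof (intro conjI allI ballI impI)
    show "to_Lin n x \<in> ops (Lin s b B) n" if "x \<in> ops P n" for n x
      using cases[OF that] piece_line by (auto simp: Lin_def Let_def L0 to_Lin_Suc)
    show "to_Lin n (x + y) = to_Lin n x + to_Lin n y" if "x \<in> ops P n" "y \<in> ops P n" for n x y
      using cases[OF that(1)] cases[OF that(2)]
      by (auto simp: L0 to_Lin_Suc line_add simp flip: scale_left_distrib)
    show "to_Lin n (scale P a x) = scale (Lin s b B) a (to_Lin n x)" if "x \<in> ops P n" for n a x
      using cases[OF that] by (auto simp: L0 to_Lin_Suc scale_line Lscale scale0)
    show "to_Lin n (act P n x \<sigma>) = act (Lin s b B) n (to_Lin n x) \<sigma>"
      if x: "x \<in> ops P n" and \<sigma>: "\<sigma> permutes {1..n}" for n \<sigma> x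
    proof -
      consider "n = 0" "x = 0" | k a where "n = Suc k" "x = scale P a (e k)"
        using cases[OF x] by blast
      then show ?thesis
      proof cases
        case 1
        then show ?thesis by (simp add: Lin_def Let_def to_Lin_def scale0)
      next
        case 2
        have "\<chi> k \<sigma> = sign_twist s \<sigma>"
        proof (cases "k = 0")
          case True
          then have "\<sigma> permutes {1}" using \<sigma> 2 by (simp add: One_nat_def)
          then have "\<sigma> = id" by simp
          then show ?thesis by (simp add: \<chi>_id[unfolded id_def] sign_twist_def id_def)
        next
          case False
          then show ?thesis using \<chi>_eq_sign_twist \<sigma> 2 sgn_at_const[of k] by simp
        qed
        then show ?thesis
          using 2 \<sigma> by (simp add: act_scale_e to_Lin_Suc Lin_def Let_def scale_line mult.commute)
      qed
    qed
    show "to_Lin 1 (ident P) = ident (Lin s b B)"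
      using to_Lin_Suc[of 0 1] by (simp add: e_0 line_def Lin_def Let_def adjoin_c_def One_nat_def)
    show "to_Lin (m + n - 1) (pcomp P m n i x y)
        = pcomp (Lin s b B) m n i (to_Lin m x) (to_Lin n y)"
      if xy: "x \<in> ops P m" "y \<in> ops P n" "1 \<le> i \<and> i \<le> m" for m n i x y
    proof -
      obtain k a where x: "m = Suc k" "x = scale P a (e k)" using cases[OF xy(1)] xy(3) by auto
      consider "n = 0" "y = 0" | l c where "n = Suc l" "y = scale P c (e l)"
        using cases[OF xy(2)] by blast
      then show ?thesis
      proof cases
        case 1
        have "pcomp P m n i x 0 = 0"
          using pcomp_scale_right[OF xy(1) zero, of i n 0] xy(3) by simp
        moreover have "amult (adjoin_c b B) (line k a) 0 = 0"
          using amult_line[of k a 0 0] by simp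
        ultimately show ?thesis
          using 1 x by (simp add: L0 to_Lin_Suc Lin_def Let_def scale0)
      next
        case 2
        have "pcomp P m n i x y = scale P (a * c * C k l i) (e (k + l))"
          using x 2 xy(3) by (simp add: pcomp_scale_e)
        moreover have "C k l i = s ^ ((i - 1) * l) * \<gamma> k l"
          using C_eq x xy(3) by blast
        ultimately show ?thesis
          using x 2 by (simp add: to_Lin_Suc Lin_def Let_def amult_line scale_line ac_simps)
      qed
    qed
  qed
qed

lemma operad_iso_to_Lin: "operad_iso to_Lin P (Lin s b B)"
  unfolding operad_iso_def
proof (intro conjI allI)
  show "bij_betw (to_Lin n) (ops P n) (ops (Lin s b B) n)" for n
  proof (cases n)
    case 0
    then show ?thesis using reduced by (simp add: bij_betw_def Lin_def Let_def to_Lin_def)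
  next
    case (Suc k)
    have "ops (Lin s b B) (Suc k) = range (line k)"
      using d_pos by (auto simp: Lin_def Let_def adjoin_c_def line_def)
    then show ?thesis
      by (auto simp: Suc bij_betw_def inj_on_def ops_Suc to_Lin_Suc image_image)
  qed
qed (rule operad_hom_to_Lin)

end

theorem theorem0p7:
  fixes P :: "('k::field, 'v::ab_group_add) operad_data"
  assumes "CHAR('k) \<noteq> 2"
    and "operad P"
    and "finitely_generated P"
    and "saturated P"
    and "linear_operad P"
  shows "(\<exists>b (B :: ('k, 'k poly) graded_data).
            cyclic_graded_algebra b B \<and> commutative_algebra b B \<and> nilpotent_algebra b B \<and>
            isomorphic_operads P (Lin_e b B)) \<or>
         (\<exists>b (B :: ('k, 'k poly) graded_data).
            odd b \<and> cyclic_graded_algebra b B \<and> graded_commutative b B \<and> nilpotent_algebra b B \<and>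
            isomorphic_operads P (Lin_o b B))"
proof -
  have "left_torsionfree P" using assms(4) by (simp add: saturated_def)
  then obtain e d where "regular_linear_operad P e d"
    using ex_regular_linear_operad assms by blast
  then interpret regular_linear_operad P e d .
  have iso: "isomorphic_operads P (Lin s b B)"
    unfolding isomorphic_operads_def using operad_iso_to_Lin by blast
  from s_odd_case show ?thesis
  proof (elim disjE conjE)
    assume s: "s = 1"
    have "\<gamma> i j = \<gamma> j i" for i j
      using \<gamma>_commute[where i = j and j = i] unfolding s power_one mult_1_left .
    then have "commutative_algebra b B" by (rule commutative_algebra)
    moreover have "Lin s b B = Lin_e b B"
      unfolding s by (rule Lin_1) (simp add: fun_eq_iff)
    ultimately show ?thesis
      using cyclic_graded_algebra nilpotent_algebra iso by metis
  next
    assume s: "s = -1" and "even d"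
    have "\<gamma> i j = (-1) ^ (i * j) * \<gamma> j i" for i j
      using \<gamma>_commute[where i = j and j = i] unfolding s by (simp only: mult.commute)
    then have "graded_commutative b B" by (rule graded_commutative)
    moreover have "Lin s b B = Lin_o b B"
      unfolding s by (rule Lin_minus_1)
    moreover have "odd b" using \<open>even d\<close> b_plus_1(2) by (metis even_Suc)
    ultimately show ?thesis
      using cyclic_graded_algebra nilpotent_algebra iso by metis
  qed
qed

end
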